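(* For $n\ge 0$ let $T_n=K_{1,1,n}$ and let $P_n(x)=P_{T_n}(x)$ be the Kazhdan--Lusztig polynomial of the graphic matroid of $T_n$. For every integer $n\ge 2$ and every real number $\lambda$ with $0\le\lambda\le n/2$, the polynomial $P_n(x)+\lambda x$ has exactly $\lfloor n/2\rfloor$ (complex) zeros, all of which are negative real numbers and simple.
   Context: $K_{1,1,n}$ is the complete tripartite graph with parts of sizes $1,1,n$ (for $n=0$ it is a single edge); equivalently, it is $K_{2,n}$ together with an edge joining the two vertices of the part of size $2$. Its graphic matroid has rank $n+1$. Kazhdan--Lusztig polynomial of a matroid (Elias--Proudfoot--Wakefield): to every loopless matroid $M$ on a finite ground set there is a unique way to assign a polynomial $P_M(x)\in\mathbb Z[x]$ such that (1) if $\operatorname{rk}M=0$ then $P_M(x)=1$; (2) if $\operatorname{rk}M>0$ then $\deg P_M<\tfrac12\operatorname{rk}M$; (3) for every $M$, $x^{\operatorname{rk}M}P_M(x^{-1})=\sum_{F}\chi_{M|F}(x)\,P_{M/F}(x)$, where $F$ ranges over the flats of $M$, $M|F$ is the restriction of $M$ to $F$, $M/F$ is the contraction of $M$ by $F$, and $\chi_{N}(x)=\sum_{G}\mu_N(\emptyset,G)\,x^{\operatorname{rk}N-\operatorname{rk}G}$ (sum over flats $G$ of $N$, $\mu_N$ the Möbius function of the lattice of flats) is the characteristic polynomial. For a graph $G$, $P_G$ denotes the Kazhdan--Lusztig polynomial of its graphic matroid. *)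

theory Defs
  imports Complex_Main "HOL-Computational_Algebra.Polynomial"
begin

section \<open>Matroids on finite ground sets\<close>

datatype 'a matroid = Matroid (ground: "'a set") (indeps: "'a set set")

definition is_matroid :: "'a matroid \<Rightarrow> bool" where
  "is_matroid M \<longleftrightarrow>
     finite (ground M) \<and>
     indeps M \<subseteq> Pow (ground M) \<and>
     {} \<in> indeps M \<and>
     (\<forall>I\<in>indeps M. \<forall>J. J \<subseteq> I \<longrightarrow> J \<in> indeps M) \<and>
     (\<forall>I\<in>indeps M. \<forall>J\<in>indeps M. card I < card J \<longrightarrow> (\<exists>e\<in>J - I. insert e I \<in> indeps M))"

definition loopless :: "'a matroid \<Rightarrow> bool" where
  "loopless M \<longleftrightarrow> (\<forall>e\<in>ground M. {e} \<in> indeps M)"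

definition rank_of :: "'a matroid \<Rightarrow> 'a set \<Rightarrow> nat" where
  "rank_of M A = Max (card ` {I \<in> indeps M. I \<subseteq> A})"

definition rk :: "'a matroid \<Rightarrow> nat" where
  "rk M = rank_of M (ground M)"

definition flats :: "'a matroid \<Rightarrow> 'a set set" where
  "flats M = {F. F \<subseteq> ground M \<and> (\<forall>e\<in>ground M - F. rank_of M F < rank_of M (insert e F))}"

definition restriction :: "'a matroid \<Rightarrow> 'a set \<Rightarrow> 'a matroid" where
  "restriction M F = Matroid F {I \<in> indeps M. I \<subseteq> F}"

definition contraction :: "'a matroid \<Rightarrow> 'a set \<Rightarrow> 'a matroid" where
  "contraction M F =
     Matroid (ground M - F)
       {I. I \<subseteq> ground M - F \<and> rank_of M (I \<union> F) = card I + rank_of M F}"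


section \<open>Characteristic polynomial\<close>

text \<open>The Moebius function of a family \<open>L\<close> of finite sets, ordered by inclusion
  (for \<open>A\<close> and \<open>B\<close> in \<open>L\<close>). The finiteness guard is only there for termination.\<close>

function moebius :: "'a set set \<Rightarrow> 'a set \<Rightarrow> 'a set \<Rightarrow> int" where
  "moebius L A B =
     (if A = B then 1
      else if A \<subset> B \<and> finite B then - (\<Sum>C | C \<in> L \<and> A \<subseteq> C \<and> C \<subset> B. moebius L A C)
      else 0)"
  by auto
termination
  by (relation "measure (\<lambda>(L, A, B). card B)") (auto intro: psubset_card_mono)

declare moebius.simps [simp del]

definition char_poly :: "'a matroid \<Rightarrow> int poly" where
  "char_poly N = (\<Sum>G\<in>flats N. monom (moebius (flats N) {} G) (rk N - rank_of N G))"


section \<open>Kazhdan--Lusztig polynomials\<close>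

text \<open>The left-hand side of the last condition is \<open>x ^ rk M * P M (1 / x)\<close>: the library's
  \<open>reflect_poly p\<close> is \<open>x ^ degree p * p (1 / x)\<close>, and \<open>degree (P M) \<le> rk M\<close> by the first two
  conditions.\<close>

definition KL_assignment :: "('a matroid \<Rightarrow> int poly) \<Rightarrow> bool" where
  "KL_assignment P \<longleftrightarrow>
     (\<forall>M. is_matroid M \<and> loopless M \<longrightarrow>
        (rk M = 0 \<longrightarrow> P M = 1) \<and>
        (rk M > 0 \<longrightarrow> real (degree (P M)) < real (rk M) / 2) \<and>
        monom 1 (rk M - degree (P M)) * reflect_poly (P M) =
          (\<Sum>F\<in>flats M. char_poly (restriction M F) * P (contraction M F)))"

text \<open>Assignments are only determined on loopless matroids, so the description ranges over the
  value at \<open>M\<close> and not over the assignment. Restricting to matroids with elements in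
  one type is harmless, since the conditions at \<open>M\<close> involve only minors of \<open>M\<close>.\<close>

definition KL_poly :: "'a matroid \<Rightarrow> int poly" where
  "KL_poly M = (THE p. \<exists>P. KL_assignment P \<and> P M = p)"


section \<open>Graphic matroids and complete tripartite graphs\<close>

text \<open>A simple graph is given by its edges, which are two-element sets of vertices; isolated
  vertices do not affect the graphic matroid.\<close>

definition graph_cycle :: "'v set set \<Rightarrow> 'v list \<Rightarrow> bool" where
  "graph_cycle E vs \<longleftrightarrow>
     3 \<le> length vs \<and> distinct vs \<and>
     (\<forall>i<length vs. {vs ! i, vs ! (Suc i mod length vs)} \<in> E)"

definition graphic_matroid :: "'v set set \<Rightarrow> 'v set matroid" where
  "graphic_matroid E = Matroid E {F. F \<subseteq> E \<and> (\<nexists>vs. graph_cycle F vs)}"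

definition complete_tripartite :: "'v set \<Rightarrow> 'v set \<Rightarrow> 'v set \<Rightarrow> 'v set set" where
  "complete_tripartite A B C =
     {{u, v} | u v. u \<in> A \<and> v \<in> B \<or> u \<in> A \<and> v \<in> C \<or> u \<in> B \<and> v \<in> C}"

definition K11 :: "nat \<Rightarrow> nat set set" where
  "K11 n = complete_tripartite {0} {1} {2..<n + 2}"

definition KL_K11 :: "nat \<Rightarrow> int poly" where
  "KL_K11 n = KL_poly (graphic_matroid (K11 n))"

end

theory Submission
  imports
    Defs
    "HOL-Analysis.Equivalence_Lebesgue_Henstock_Integration"
    "HOL-Computational_Algebra.Formal_Power_Series"
begin

text \<open>
  Existence and uniqueness of Kazhdan--Lusztig polynomials are handled through the polynomial
  \<open>Z\<^sub>M = \<Sum>\<^sub>F x\<^bsup>rk F\<^esup> P\<^bsub>M/F\<^esub>\<close>: once the polynomials of the proper contractions are known,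
  a unique \<open>P\<^sub>M\<close> of degree less than \<open>rk M / 2\<close> makes \<open>Z\<^sub>M\<close> palindromic of degree \<open>rk M\<close>, and
  Moebius inversion turns this into the defining recursion. The flats of \<open>K\<^bsub>1,1,n\<^esub>\<close> reduce the
  palindromicity of \<open>Z\<close> to a binomial identity, solved by \<open>P\<^sub>n(x) = \<Sum>\<^sub>i c\<^bsub>n,i\<^esub> (x - 1)\<^sup>i\<close> with
  \<open>c\<^bsub>n,i\<^esub> = (2 n - 2 i choose n) (n + 1 choose i) / (n + 1)\<close>.

  Substituting \<open>t = 1 - 1 / x\<^sup>2\<close>, the function \<open>x\<^sup>n P\<^sub>n(t)\<close> on \<open>[0, 1]\<close>, continued by \<open>x\<^bsup>-n-2\<^esup>\<close> to
  \<open>[1, \<infinity>)\<close>, is orthogonal to \<open>x\<^bsup>n-2j\<^esup>\<close> for \<open>1 \<le> j \<le> \<lfloor>n/2\<rfloor>\<close>. If \<open>P\<^sub>n + \<lambda> x\<close> had fewer than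
  \<open>\<lfloor>n/2\<rfloor>\<close> sign changes on the negative axis, then integrating against a polynomial with exactly
  these sign changes would give a positive number instead of \<open>0\<close>, since the term with \<open>\<lambda> \<le> n/2\<close>
  is dominated by the tail.
\<close>

section \<open>Coefficient reversal\<close>

text \<open>All constants have one origin. For i = 0, ..., n the numbers (2 n - 2 i choose n) are
  values of a polynomial in i of degree n, whose finite difference of order n + 1 is zero; the extra
  node i = n + 1 carries the value (-2 choose n) = (-1)^n (n + 1). Since (t - 1)^i = (-1)^i x^(-2
  i), this node stands for a summand - x^(-n-2) missing from x^n P_n(t). The formal integral of -
  x^(-2j-2) over [0, 1] is the integral of x^(-2j-2) over [1, \<infinity>), hence the tail. Dividing
  the polynomial by one of its linear factors gives the orthogonality relations.

  The term \<lambda> x is not covered by orthogonality and has to be absorbed pointwise. The number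
  of sign changes cannot fall short by exactly one: the cofactor would be linear with positive
  leading coefficient, yet nonnegative on the negative axis. So at least two are missing, the test
  polynomial has a spare power of x^2, and (N + 1) y^N (1 - y) \<le> 1 on [0, 1] leaves room for
  \<lambda> up to n/2.\<close>

definition rv :: "nat \<Rightarrow> 'a::comm_ring_1 poly \<Rightarrow> 'a poly" where
  "rv r p = (\<Sum>i\<le>r. monom (coeff p (r - i)) i)"

lemma coeff_rv: "coeff (rv r p) i = (if i \<le> r then coeff p (r - i) else 0)"
  by (auto simp: rv_def coeff_sum)

lemma rv_add: "rv r (p + q) = rv r p + rv r q"
  by (rule poly_eqI) (simp add: coeff_rv)

lemma rv_diff: "rv r (p - q) = rv r p - rv r q"
  by (rule poly_eqI) (simp add: coeff_rv)

lemma rv_sum: "rv r (sum f A) = (\<Sum>x\<in>A. rv r (f x))"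
  by (rule poly_eqI) (simp add: coeff_rv coeff_sum)

lemma rv_monom_mult: "rv (k + r) (monom 1 k * p) = rv r p"
  by (rule poly_eqI) (auto simp: coeff_rv coeff_monom_mult)

text \<open>Reversal at a prescribed degree \<open>r\<close> is additive, unlike
  \<open>reflect_poly\<close>, which follows the actual degree. This is the link to the form used in
  \<open>KL_assignment\<close>.\<close>

lemma rv_eq_reflect_poly:
  assumes "degree p \<le> r"
  shows "monom 1 (r - degree p) * reflect_poly p = rv r p"
proof (rule poly_eqI)
  fix i
  show "coeff (monom 1 (r - degree p) * reflect_poly p) i = coeff (rv r p) i"
    using assms by (auto simp: coeff_rv coeff_monom_mult coeff_reflect_poly coeff_eq_0)
qed

lemma rv_fixed_eq_0:
  assumes "rv r d = d" and "2 * degree d < r"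
  shows "d = 0"
proof (rule poly_eqI)
  fix i
  show "coeff d i = coeff 0 i"
  proof (cases "i \<le> degree d")
    case True
    then have "coeff d i = coeff d (r - i)"
      using assms by (metis coeff_rv le_trans nat_less_le linear trans_less_add1 mult_2)
    moreover have "degree d < r - i"
      using True assms(2) by linarith
    ultimately show ?thesis
      by (simp add: coeff_eq_0)
  qed (simp add: coeff_eq_0)
qed

text \<open>All uniqueness statements rest on this: a polynomial of degree below r/2 is determined
  by its failure to be palindromic.\<close>

lemma rv_eqI:
  assumes "rv r p - p = rv r q - q" and "2 * degree p < r" and "2 * degree q < r"
  shows "p = q"
proof -
  have "rv r (p - q) = p - q"
    using assms(1) by (simp add: rv_diff algebra_simps)
  moreover have "2 * degree (p - q) < r"
    using degree_diff_le_max[of p q] assms(2,3) by linarith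
  ultimately show ?thesis
    using rv_fixed_eq_0 by fastforce
qed

text \<open>The existence counterpart of \<open>rv_eqI\<close>: the lower half of \<open>R\<close>
  is corrected to mirror the upper half, and a middle coefficient is its own mirror image.\<close>

lemma rv_symmetrize:
  fixes R :: "'a::comm_ring_1 poly"
  assumes "degree R \<le> r" and "0 < r"
  defines "p \<equiv> (\<Sum>i | 2 * i < r. monom (coeff R (r - i) - coeff R i) i)"
  shows "rv r (p + R) = p + R" and "2 * degree p < r"
proof -
  have fin: "finite {i. 2 * i < r}"
    by (rule finite_subset[of _ "{..r}"]) auto
  have c: "coeff p i = (if 2 * i < r then coeff R (r - i) - coeff R i else 0)" for i
    using fin by (simp add: p_def coeff_sum)
  show "rv r (p + R) = p + R"
  proof (rule poly_eqI)
    fix i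
    consider "2 * i < r" | "2 * i = r" | "2 * i > r" "i \<le> r" | "i > r" by linarith
    then show "coeff (rv r (p + R)) i = coeff (p + R) i"
      using assms(1) by cases (auto simp: coeff_rv c coeff_eq_0 intro!: arg_cong[of _ _ "coeff R"])
  qed
  have "degree p \<le> (r - 1) div 2"
    using c by (intro degree_le) auto
  then show "2 * degree p < r"
    using assms(2) by linarith
qed

lemma poly_rv:
  fixes x :: "'a::field"
  assumes "degree p \<le> r" and "x \<noteq> 0"
  shows "poly (rv r p) x = x ^ r * poly p (1 / x)"
proof -
  have "poly (rv r p) x = (\<Sum>i\<le>r. coeff p (r - i) * x ^ i)"
    by (simp add: rv_def poly_sum poly_monom)
  also have "\<dots> = (\<Sum>i\<le>r. coeff p i * x ^ (r - i))"
    by (rule sum.reindex_bij_witness[of _ "\<lambda>i. r - i" "\<lambda>i. r - i"]) auto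
  also have "\<dots> = x ^ r * (\<Sum>i\<le>r. coeff p i * (1 / x) ^ i)"
    using assms(2) by (auto simp: sum_distrib_left power_diff power_one_over field_simps intro!: sum.cong)
  also have "(\<Sum>i\<le>r. coeff p i * (1 / x) ^ i) = poly p (1 / x)"
    using assms(1) by (auto simp: poly_altdef intro!: sum.mono_neutral_right le_degree)
  finally show ?thesis .
qed

section \<open>Minors of matroids\<close>

locale finite_matroid =
  fixes M :: "'a matroid"
  assumes matroid: "is_matroid M"
begin

abbreviation "r \<equiv> rank_of M"

lemma finite_ground [simp, intro]: "finite (ground M)"
  using matroid by (simp add: is_matroid_def)

lemma indep_subset: "I \<in> indeps M \<Longrightarrow> I \<subseteq> ground M"
  using matroid by (auto simp: is_matroid_def)

lemma indep_finite: "I \<in> indeps M \<Longrightarrow> finite I"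
  using indep_subset finite_ground finite_subset by blast

lemma indep_empty [simp, intro]: "{} \<in> indeps M"
  using matroid by (simp add: is_matroid_def)

lemma indep_mono: "I \<in> indeps M \<Longrightarrow> J \<subseteq> I \<Longrightarrow> J \<in> indeps M"
  using matroid by (simp add: is_matroid_def)

lemma indep_exchange:
  "I \<in> indeps M \<Longrightarrow> J \<in> indeps M \<Longrightarrow> card I < card J \<Longrightarrow> \<exists>e\<in>J - I. insert e I \<in> indeps M"
  using matroid by (simp add: is_matroid_def)

lemma finite_indeps: "finite (indeps M)"
  using matroid by (auto simp: is_matroid_def intro: finite_subset[of _ "Pow (ground M)"])

lemma indep_card_le_rank: "I \<in> indeps M \<Longrightarrow> I \<subseteq> A \<Longrightarrow> card I \<le> r A"
  using finite_indeps by (auto simp: rank_of_def)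

lemma basis_exists: "\<exists>I. I \<in> indeps M \<and> I \<subseteq> A \<and> card I = r A"
proof -
  have "Max (card ` {I \<in> indeps M. I \<subseteq> A}) \<in> card ` {I \<in> indeps M. I \<subseteq> A}"
    using finite_indeps indep_empty by (intro Max_in) auto
  then show ?thesis by (auto simp: rank_of_def)
qed

lemma basis_extend:
  assumes "I \<in> indeps M" and "I \<subseteq> A"
  shows "\<exists>B. B \<in> indeps M \<and> I \<subseteq> B \<and> B \<subseteq> A \<and> card B = r A"
  using assms
proof (induction "r A - card I" arbitrary: I rule: less_induct)
  case less
  obtain J where J: "J \<in> indeps M" "J \<subseteq> A" "card J = r A"
    using basis_exists by blast
  show ?case
  proof (cases "card I < card J")
    case True
    obtain e where e: "e \<in> J - I" "insert e I \<in> indeps M"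
      using indep_exchange[OF less.prems(1) J(1) True] by blast
    have "card (insert e I) = Suc (card I)"
      using e(1) indep_finite[OF less.prems(1)] by simp
    moreover have "insert e I \<subseteq> A"
      using e(1) J(2) less.prems by blast
    ultimately obtain B where "B \<in> indeps M" "insert e I \<subseteq> B" "B \<subseteq> A" "card B = r A"
      using less.hyps[OF _ e(2)] True J(3) by (metis diff_less_mono2 lessI)
    then show ?thesis by blast
  next
    case False
    then show ?thesis
      using less.prems J(3) indep_card_le_rank[OF less.prems] by auto
  qed
qed

lemma rank_mono: "A \<subseteq> B \<Longrightarrow> r A \<le> r B"
  by (metis basis_exists indep_card_le_rank subset_trans)

lemma rank_Un_le:
  assumes "finite I"
  shows "r (I \<union> F) \<le> card I + r F"
proof -
  obtain B where B: "B \<in> indeps M" "B \<subseteq> I \<union> F" "card B = r (I \<union> F)"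
    using basis_exists by blast
  have "card B = card (B - F) + card (B \<inter> F)"
    using indep_finite[OF B(1)] by (metis Int_Diff_Un Int_Diff_disjoint add.commute card_Un_disjoint finite_Diff finite_Int)
  moreover have "card (B \<inter> F) \<le> r F"
    using B(1) indep_mono by (intro indep_card_le_rank) auto
  moreover have "card (B - F) \<le> card I"
    using B(2) assms by (intro card_mono) auto
  ultimately show ?thesis using B(3) by linarith
qed

lemma rank_insert_le: "r (insert e F) \<le> Suc (r F)"
  using rank_Un_le[of "{e}" F] by simp

lemma rank_empty [simp]: "r {} = 0"
  using basis_exists[of "{}"] by auto

lemma rank_indep: "I \<in> indeps M \<Longrightarrow> r I = card I"
proof -
  assume I: "I \<in> indeps M"
  obtain B where B: "B \<in> indeps M" "B \<subseteq> I" "card B = r I"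
    using basis_exists by blast
  then have "card B \<le> card I"
    using indep_finite[OF I] by (intro card_mono)
  then show ?thesis
    using B indep_card_le_rank[OF I order_refl] by linarith
qed

lemma indep_iff_rank:
  assumes "I \<subseteq> ground M"
  shows "I \<in> indeps M \<longleftrightarrow> r I = card I"
proof
  assume "r I = card I"
  moreover obtain B where "B \<in> indeps M" "B \<subseteq> I" "card B = r I"
    using basis_exists by blast
  ultimately show "I \<in> indeps M"
    using assms finite_subset[OF assms finite_ground] card_subset_eq by metis
qed (rule rank_indep)

lemma ground_restriction [simp]: "ground (restriction M F) = F"
  by (simp add: restriction_def)

lemma ground_contraction [simp]: "ground (contraction M F) = ground M - F"
  by (simp add: contraction_def)

lemma rank_restriction:
  assumes "A \<subseteq> F"
  shows "rank_of (restriction M F) A = r A"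
  unfolding rank_of_def restriction_def using assms by (auto intro!: arg_cong[of _ _ "\<lambda>X. Max (card ` X)"])

text \<open>Independence in the contraction is tested with one fixed basis \<open>B\<close> of
  \<open>F\<close>. Exchange between \<open>I \<union> B\<close> and \<open>J \<union> B\<close>
  then passes to \<open>I\<close> and \<open>J\<close>, because the element added is never in
  \<open>B\<close>.\<close>

lemma indeps_contraction_eq:
  assumes "F \<subseteq> ground M" and B: "B \<in> indeps M" "B \<subseteq> F" "card B = r F"
  shows "indeps (contraction M F) = {I. I \<subseteq> ground M - F \<and> I \<union> B \<in> indeps M}"
proof -
  have "r (I \<union> F) = card I + r F \<longleftrightarrow> I \<union> B \<in> indeps M" if I: "I \<subseteq> ground M - F" for I
  proof -
    have fin: "finite I" "finite B"
      using I B finite_subset[of I "ground M"] indep_finite by auto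
    have card: "card (I \<union> B) = card I + r F"
      using I B fin by (subst card_Un_disjoint) auto
    show ?thesis
    proof
      assume eq: "r (I \<union> F) = card I + r F"
      obtain B' where B': "B' \<in> indeps M" "B \<subseteq> B'" "B' \<subseteq> I \<union> F" "card B' = r (I \<union> F)"
        using basis_extend[of B "I \<union> F"] B by auto
      \<comment> \<open>The part of \<open>B'\<close> inside \<open>F\<close> contains the basis
        \<open>B\<close> of \<open>F\<close> and is independent, so it cannot be larger than
        \<open>B\<close>.\<close>
      have "card (B' \<inter> F) \<le> r F"
        using B'(1) indep_mono by (intro indep_card_le_rank) auto
      then have "B' \<inter> F = B"
        using B B' indep_finite[OF B'(1)] by (intro card_seteq[symmetric]) auto
      then have "B' \<subseteq> I \<union> B"
        using B' by blast
      then have "B' = I \<union> B"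
        using fin card eq B'(4) by (intro card_subset_eq) auto
      then show "I \<union> B \<in> indeps M" using B' by simp
    next
      assume "I \<union> B \<in> indeps M"
      then have "card (I \<union> B) \<le> r (I \<union> F)"
        using B by (intro indep_card_le_rank) auto
      then show "r (I \<union> F) = card I + r F"
        using rank_Un_le[OF fin(1), of F] card by simp
    qed
  qed
  then show ?thesis by (auto simp: contraction_def)
qed

lemma matroid_contraction:
  assumes "F \<subseteq> ground M"
  shows "is_matroid (contraction M F)"
proof -
  obtain B where B: "B \<in> indeps M" "B \<subseteq> F" "card B = r F"
    using basis_exists by blast
  note eq = indeps_contraction_eq[OF assms B]
  have *: "\<exists>e\<in>J - I. insert e I \<in> indeps (contraction M F)"
    if IJ: "I \<in> indeps (contraction M F)" "J \<in> indeps (contraction M F)" "card I < card J" for I J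
  proof -
    have I: "I \<subseteq> ground M - F" "I \<union> B \<in> indeps M" and J: "J \<subseteq> ground M - F" "J \<union> B \<in> indeps M"
      using IJ by (auto simp: eq)
    have "finite I" "finite J" "finite B"
      using I J indep_finite by auto
    then have "card (I \<union> B) < card (J \<union> B)"
      using I J B IJ(3) by (subst (1 2) card_Un_disjoint) auto
    then obtain e where "e \<in> (J \<union> B) - (I \<union> B)" "insert e (I \<union> B) \<in> indeps M"
      using indep_exchange I J by blast
    then show ?thesis
      using I J by (auto simp: eq)
  qed
  have "J \<in> indeps (contraction M F)" if "I \<in> indeps (contraction M F)" "J \<subseteq> I" for I J
    using that indep_mono[of "I \<union> B" "J \<union> B"] by (auto simp: eq)
  moreover have "{} \<in> indeps (contraction M F)" "finite (ground M - F)"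
      "indeps (contraction M F) \<subseteq> Pow (ground M - F)"
    using B by (auto simp: eq)
  ultimately show ?thesis
    using * by (simp add: is_matroid_def)
qed

lemma rank_contraction:
  assumes F: "F \<subseteq> ground M" and A: "A \<subseteq> ground M - F"
  shows "rank_of (contraction M F) A + r F = r (A \<union> F)"
proof -
  interpret C: finite_matroid "contraction M F"
    using matroid_contraction[OF F] by unfold_locales
  obtain B where B: "B \<in> indeps M" "B \<subseteq> F" "card B = r F"
    using basis_exists by blast
  note eq = indeps_contraction_eq[OF F B]
  obtain I where I: "I \<in> indeps (contraction M F)" "I \<subseteq> A" "card I = C.r A"
    using C.basis_exists by blast
  have "card (I \<union> B) = card I + card B"
    using I B A indep_finite C.indep_finite by (intro card_Un_disjoint) auto
  moreover have "card (I \<union> B) \<le> r (A \<union> F)"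
    using I B by (intro indep_card_le_rank) (auto simp: eq)
  ultimately have le: "C.r A + r F \<le> r (A \<union> F)"
    using I B by simp
  obtain B' where B': "B' \<in> indeps M" "B \<subseteq> B'" "B' \<subseteq> A \<union> F" "card B' = r (A \<union> F)"
    using basis_extend[of B "A \<union> F"] B by auto
  have "card (B' \<inter> F) \<le> r F"
    using B'(1) indep_mono by (intro indep_card_le_rank) auto
  then have "B' \<inter> F = B"
    using B B' indep_finite[OF B'(1)] by (intro card_seteq[symmetric]) auto
  then have sub: "B' - B \<subseteq> A"
    using B' by blast
  have "(B' - B) \<union> B \<in> indeps M"
    using B' by (simp add: Un_absorb2)
  then have "B' - B \<in> indeps (contraction M F)"
    using sub A by (auto simp: eq)
  then have "card (B' - B) \<le> C.r A"
    using sub by (intro C.indep_card_le_rank)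
  moreover have "card (B' - B) = card B' - card B"
    using B' B indep_finite by (intro card_Diff_subset) auto
  ultimately show ?thesis
    using le B B' by linarith
qed

lemma flat_subset: "F \<in> flats M \<Longrightarrow> F \<subseteq> ground M"
  by (simp add: flats_def)

lemma finite_flats [simp, intro]: "finite (flats M)"
  by (rule finite_subset[of _ "Pow (ground M)"]) (auto simp: flats_def)

lemma empty_flat:
  assumes "loopless M"
  shows "{} \<in> flats M"
  using assms by (auto simp: flats_def loopless_def rank_indep)

lemma rank_flat_insert:
  assumes "F \<in> flats M" and "e \<in> ground M - F"
  shows "r (insert e F) = Suc (r F)"
proof -
  have "r F < r (insert e F)"
    using assms by (simp add: flats_def)
  then show ?thesis
    using rank_insert_le[of e F] by linarith
qed

text \<open>The two notions of flat differ only in the elements outside \<open>F\<close>. Such an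
  element raises the rank of \<open>F\<close>, hence of every subset \<open>G\<close> of
  \<open>F\<close>: extend a basis of \<open>G\<close> to one of \<open>F\<close> and then to one of
  \<open>insert e F\<close>; the last one must contain \<open>e\<close>.\<close>

lemma flats_restriction:
  assumes F: "F \<in> flats M"
  shows "flats (restriction M F) = {G \<in> flats M. G \<subseteq> F}"
proof -
  have "r G < r (insert e G)" if G: "G \<subseteq> F" and e: "e \<in> ground M - F" for G e
  proof -
    obtain B where B: "B \<in> indeps M" "B \<subseteq> G" "card B = r G"
      using basis_exists by blast
    obtain B' where B': "B' \<in> indeps M" "B \<subseteq> B'" "B' \<subseteq> F" "card B' = r F"
      using basis_extend[of B F] B G by auto
    obtain B'' where B'': "B'' \<in> indeps M" "B' \<subseteq> B''" "B'' \<subseteq> insert e F" "card B'' = Suc (r F)"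
      using basis_extend[of B' "insert e F"] B' rank_flat_insert[OF F e] by auto
    have "e \<in> B''"
    proof (rule ccontr)
      assume "e \<notin> B''"
      then have "card B'' \<le> r F"
        using B'' by (intro indep_card_le_rank) auto
      then show False using B'' by simp
    qed
    then have "insert e B \<in> indeps M"
      using B' B'' indep_mono[of B'' "insert e B"] by blast
    then have "card (insert e B) \<le> r (insert e G)"
      using B by (intro indep_card_le_rank) auto
    moreover have "card (insert e B) = Suc (card B)"
      using B G e indep_finite by (subst card_insert_disjoint) auto
    ultimately show ?thesis using B by simp
  qed
  then have *: "\<And>G e. G \<subseteq> F \<Longrightarrow> e \<in> ground M \<Longrightarrow> e \<notin> F \<Longrightarrow> r G < r (insert e G)"
    by blast
  show ?thesis
    using flat_subset[OF F] *
    by (auto simp: flats_def rank_restriction) (metis DiffI)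
qed

lemma flats_contraction:
  assumes F: "F \<subseteq> ground M"
  shows "G \<in> flats (contraction M F) \<longleftrightarrow> G \<subseteq> ground M - F \<and> G \<union> F \<in> flats M"
proof -
  have "rank_of (contraction M F) G < rank_of (contraction M F) (insert e G) \<longleftrightarrow>
      r (G \<union> F) < r (insert e (G \<union> F))" if "G \<subseteq> ground M - F" "e \<in> ground M - F - G" for e
    using rank_contraction[OF F, of G] rank_contraction[OF F, of "insert e G"] that by auto
  then show ?thesis
    using F by (auto simp: flats_def)
qed

lemma loopless_contraction:
  assumes F: "F \<in> flats M"
  shows "loopless (contraction M F)"
  using rank_flat_insert[OF F] by (auto simp: loopless_def contraction_def)

text \<open>An equality of matroids and not merely an isomorphism, so any function on matroids takes
  the same value on both sides.\<close>

lemma contraction_contraction: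
  assumes F: "F \<subseteq> G" and G: "G \<subseteq> ground M"
  shows "contraction (contraction M F) (G - F) = contraction M G"
proof -
  have g: "ground (contraction M F) - (G - F) = ground M - G"
    using F by (auto simp: contraction_def)
  have "rank_of (contraction M F) (I \<union> (G - F)) = card I + rank_of (contraction M F) (G - F) \<longleftrightarrow>
      r (I \<union> G) = card I + r G" if I: "I \<subseteq> ground M - G" for I
  proof -
    have "I \<union> (G - F) \<union> F = I \<union> G" "G - F \<union> F = G" using F by auto
    moreover have "F \<subseteq> ground M" "I \<union> (G - F) \<subseteq> ground M - F" "G - F \<subseteq> ground M - F"
      using F G I by auto
    ultimately show ?thesis
      using rank_contraction[of F "I \<union> (G - F)"] rank_contraction[of F "G - F"] by auto
  qed
  then show ?thesis
    unfolding contraction_def[of "contraction M F"] g by (auto simp: contraction_def[of M G])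
qed

lemma contraction_empty: "contraction M {} = M"
proof -
  have "{I. I \<subseteq> ground M \<and> r I = card I} = indeps M"
    using indep_iff_rank indep_subset by blast
  then show ?thesis
    by (intro matroid.expand) (simp add: contraction_def)
qed

lemma rk_contraction:
  assumes "F \<subseteq> ground M"
  shows "rk (contraction M F) + r F = rk M"
  using rank_contraction[OF assms, of "ground M - F"] assms
  by (simp add: rk_def contraction_def Un_absorb2)

end

section \<open>Existence and uniqueness of Kazhdan--Lusztig polynomials\<close>

definition symmetrizer :: "nat \<Rightarrow> 'a::comm_ring_1 poly \<Rightarrow> 'a poly" where
  "symmetrizer r R = (\<Sum>i | 2 * i < r. monom (coeff R (r - i) - coeff R i) i)"

text \<open>The recursion makes the Z-polynomial palindromic instead of using the characteristic
  polynomials. The empty flat is left out because its contraction is \<open>M\<close> itself;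
  \<open>is_matroid M\<close> supplies the finite ground set that shrinks in every other
  contraction.\<close>

function kl :: "'a matroid \<Rightarrow> int poly" where
  "kl M = (if is_matroid M \<and> 0 < rk M
     then symmetrizer (rk M)
       (\<Sum>F\<in>flats M - {{}}. monom 1 (rank_of M F) * kl (contraction M F))
     else 1)"
  by auto
termination
proof (relation "Wellfounded.measure (\<lambda>M. card (ground M))")
  fix M :: "'a matroid" and F
  assume "is_matroid M \<and> 0 < rk M" and F: "F \<in> flats M - {{}}"
  then interpret finite_matroid M by unfold_locales simp
  have "F \<inter> ground M \<noteq> {}"
    using F flat_subset[of F] by auto
  then show "(contraction M F, M) \<in> Wellfounded.measure (\<lambda>M. card (ground M))"
    by (auto intro!: psubset_card_mono)
qed simp

declare kl.simps [simp del]

definition Z_poly :: "'a matroid \<Rightarrow> int poly" where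
  "Z_poly M = (\<Sum>F\<in>flats M. monom 1 (rank_of M F) * kl (contraction M F))"

lemma kl_rk_0: "rk M = 0 \<Longrightarrow> kl M = 1"
  by (simp add: kl.simps)

context finite_matroid
begin

lemma rk_eq_0_iff:
  assumes "loopless M"
  shows "rk M = 0 \<longleftrightarrow> ground M = {}"
proof
  assume *: "rk M = 0"
  show "ground M = {}"
  proof (rule ccontr)
    assume "ground M \<noteq> {}"
    then obtain e where "e \<in> ground M" by blast
    then have "card {e} \<le> r (ground M)"
      using assms by (intro indep_card_le_rank) (auto simp: loopless_def)
    then show False using * by (simp add: rk_def)
  qed
qed (simp add: rk_def)

lemma Z_poly_split:
  assumes "loopless M"
  shows "Z_poly M = kl M + (\<Sum>F\<in>flats M - {{}}. monom 1 (r F) * kl (contraction M F))"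
  unfolding Z_poly_def using empty_flat[OF assms]
  by (subst sum.remove[where x = "{}"]) (auto simp: contraction_empty monom_0 one_pCons[symmetric])

end

text \<open>Both claims go through one induction: the degree bounds for proper contractions bound
  the degree of the remaining sum by \<open>rk M\<close>, which \<open>rv_symmetrize\<close>
  requires.\<close>

lemma kl_degree_Z_poly:
  assumes "is_matroid M" and "loopless M"
  shows "(0 < rk M \<longrightarrow> 2 * degree (kl M) < rk M) \<and> rv (rk M) (Z_poly M) = Z_poly M"
  using assms
proof (induction "card (ground M)" arbitrary: M rule: less_induct)
  case less
  interpret finite_matroid M using less by unfold_locales
  show ?case
  proof (cases "rk M = 0")
    case True
    then have "flats M = {{}}"
      using rk_eq_0_iff[OF less.prems(2)] empty_flat[OF less.prems(2)] flat_subset by auto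
    then have "Z_poly M = kl M"
      using Z_poly_split[OF less.prems(2)] by simp
    then show ?thesis
      using True by (simp add: kl_rk_0 rv_def monom_0 one_pCons)
  next
    case False
    define R where "R = (\<Sum>F\<in>flats M - {{}}. monom 1 (r F) * kl (contraction M F))"
    have deg: "degree (monom 1 (r F) * kl (contraction M F)) \<le> rk M" if F: "F \<in> flats M - {{}}" for F
    proof -
      have sub: "F \<subseteq> ground M" and "F \<noteq> {}" using F flat_subset by auto
      then have "card (ground (contraction M F)) < card (ground M)"
        by (auto intro!: psubset_card_mono)
      then have "2 * degree (kl (contraction M F)) \<le> rk (contraction M F)"
        using less.hyps[of "contraction M F"] matroid_contraction[OF sub] loopless_contraction[of F] F
        by (cases "rk (contraction M F) = 0") (auto simp: kl_rk_0)
      then have "r F + degree (kl (contraction M F)) \<le> rk M"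
        using rk_contraction[OF sub] by linarith
      then show ?thesis
        using degree_mult_le[of "monom 1 (r F)" "kl (contraction M F)"] degree_monom_le[of 1 "r F"]
        by (meson add_mono le_refl le_trans)
    qed
    then have "degree R \<le> rk M"
      unfolding R_def by (intro degree_sum_le) auto
    note sym = rv_symmetrize[OF this, folded symmetrizer_def]
    have "kl M = symmetrizer (rk M) R"
      using less.prems False by (simp add: kl.simps[of M] R_def)
    then show ?thesis
      using sym False Z_poly_split[OF less.prems(2)] by (simp add: R_def)
  qed
qed

section \<open>Moebius inversion: from palindromic Z-polynomials to the defining recursion\<close>

lemma sum_const_poly: "(\<Sum>x\<in>A. [:f x:]) = [:\<Sum>x\<in>A. f x:]"
  by (induction A rule: infinite_finite_induct) auto

text \<open>The recursion for \<open>moebius\<close> only looks below \<open>B\<close>; so the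
  Moebius function of a restriction can be computed in the flats of the whole matroid.\<close>

lemma moebius_cong:
  assumes "\<And>C. C \<subseteq> B \<Longrightarrow> C \<in> L \<longleftrightarrow> C \<in> L'"
  shows "moebius L A B = moebius L' A B"
  using assms
proof (induction "card B" arbitrary: B rule: less_induct)
  case less
  have "(\<Sum>C | C \<in> L \<and> A \<subseteq> C \<and> C \<subset> B. moebius L A C) =
      (\<Sum>C | C \<in> L' \<and> A \<subseteq> C \<and> C \<subset> B. moebius L' A C)" if "finite B"
    using less that by (intro sum.cong) (auto intro!: less.hyps psubset_card_mono)
  then show ?case
    by (simp add: moebius.simps[of L A B] moebius.simps[of L' A B])
qed

lemma sum_moebius:
  assumes "finite B" and "A \<subseteq> B" and "A \<in> L" and "B \<in> L"
  shows "(\<Sum>C | C \<in> L \<and> A \<subseteq> C \<and> C \<subseteq> B. moebius L A C) = (if A = B then 1 else 0)"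
proof (cases "A = B")
  case True
  then have "{C \<in> L. A \<subseteq> C \<and> C \<subseteq> B} = {B}" using assms by auto
  then show ?thesis using True by (simp add: moebius.simps)
next
  case False
  have eq: "{C. C \<in> L \<and> A \<subseteq> C \<and> C \<subseteq> B} = insert B {C. C \<in> L \<and> A \<subseteq> C \<and> C \<subset> B}"
    using assms by auto
  have "finite {C. C \<in> L \<and> A \<subseteq> C \<and> C \<subset> B}"
    using assms(1) by (rule rev_finite_subset[OF finite_Pow_iff[THEN iffD2]]) auto
  then show ?thesis
    using False assms unfolding eq by (simp add: moebius.simps[of L A B] psubset_eq)
qed

context finite_matroid
begin

lemma flats_contraction_eq:
  assumes F: "F \<in> flats M"
  shows "flats (contraction M F) = (\<lambda>G. G - F) ` {G \<in> flats M. F \<subseteq> G}"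
proof (intro equalityI subsetI)
  fix G assume "G \<in> flats (contraction M F)"
  then have "G = (G \<union> F) - F" "G \<union> F \<in> flats M"
    using flats_contraction[OF flat_subset[OF F]] by auto
  then show "G \<in> (\<lambda>G. G - F) ` {G \<in> flats M. F \<subseteq> G}" by blast
next
  fix G assume "G \<in> (\<lambda>G. G - F) ` {G \<in> flats M. F \<subseteq> G}"
  then show "G \<in> flats (contraction M F)"
    using flats_contraction[OF flat_subset[OF F]] flat_subset by (auto simp: Un_absorb2)
qed

lemma sum_flats_contraction:
  assumes F: "F \<in> flats M"
  shows "(\<Sum>G\<in>flats (contraction M F). f (rank_of (contraction M F) G) (contraction (contraction M F) G)) =
    (\<Sum>G | G \<in> flats M \<and> F \<subseteq> G. f (r G - r F) (contraction M G))"
proof -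
  have inj: "inj_on (\<lambda>G. G - F) {G \<in> flats M. F \<subseteq> G}"
    by (rule inj_onI) auto
  have "rank_of (contraction M F) (G - F) = r G - r F" if "G \<in> flats M" "F \<subseteq> G" for G
    using rank_contraction[OF flat_subset[OF F], of "G - F"] flat_subset[of G] that
    by (auto simp: Un_absorb2 Diff_mono)
  then show ?thesis
    unfolding flats_contraction_eq[OF F] sum.reindex[OF inj] using flat_subset
    by (auto simp: contraction_contraction intro!: sum.cong)
qed

lemma Z_poly_contraction:
  assumes "F \<in> flats M"
  shows "Z_poly (contraction M F) =
    (\<Sum>G | G \<in> flats M \<and> F \<subseteq> G. monom 1 (r G - r F) * kl (contraction M G))"
  unfolding Z_poly_def using sum_flats_contraction[OF assms, of "\<lambda>k N. monom 1 k * kl N"] .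

lemma rank_flat_mono_diff:
  assumes "F \<subseteq> G" and "G \<subseteq> ground M"
  shows "rk M - r F = (r G - r F) + (rk M - r G)"
  using rank_mono[OF assms(1)] rank_mono[OF assms(2)] by (simp add: rk_def)

lemma char_poly_restriction:
  assumes F: "F \<in> flats M"
  shows "char_poly (restriction M F) =
    (\<Sum>H | H \<in> flats M \<and> H \<subseteq> F. monom (moebius (flats M) {} H) (r F - r H))"
proof -
  have "moebius (flats (restriction M F)) {} H = moebius (flats M) {} H" if "H \<subseteq> F" for H
    using that flats_restriction[OF F] by (intro moebius_cong) auto
  then show ?thesis
    unfolding char_poly_def flats_restriction[OF F] rk_def ground_restriction
    by (intro sum.cong) (auto simp: rank_restriction)
qed

text \<open>Expand the characteristic polynomials and group the pairs H \<subseteq> F by H: the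
  inner sums are the Z-polynomials of the contractions by H. Reverse them by palindromicity, group
  by F again, and the Moebius sums leave only F = {}.\<close>

lemma kl_recursion:
  assumes "loopless M"
  shows "rv (rk M) (kl M) = (\<Sum>F\<in>flats M. char_poly (restriction M F) * kl (contraction M F))"
proof -
  define \<mu> where "\<mu> H = moebius (flats M) {} H" for H
  have "(\<Sum>F\<in>flats M. char_poly (restriction M F) * kl (contraction M F)) =
      (\<Sum>F\<in>flats M. \<Sum>H | H \<in> flats M \<and> H \<subseteq> F.
        [:\<mu> H:] * (monom 1 (r F - r H) * kl (contraction M F)))"
    by (intro sum.cong refl)
      (simp add: char_poly_restriction sum_distrib_right \<mu>_def smult_monom mult_smult_left[symmetric])
  also have "\<dots> = (\<Sum>H\<in>flats M. \<Sum>F | F \<in> flats M \<and> H \<subseteq> F.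
        [:\<mu> H:] * (monom 1 (r F - r H) * kl (contraction M F)))"
    by (rule sum.swap_restrict) auto
  also have "\<dots> = (\<Sum>H\<in>flats M. [:\<mu> H:] * Z_poly (contraction M H))"
    by (intro sum.cong refl) (simp only: Z_poly_contraction sum_distrib_left)
  also have "\<dots> = (\<Sum>H\<in>flats M. \<Sum>F | F \<in> flats M \<and> H \<subseteq> F.
        [:\<mu> H:] * rv (rk M - r F) (kl (contraction M F)))"
  proof (intro sum.cong refl)
    fix H assume H: "H \<in> flats M"
    have "rk (contraction M H) = rk M - r H"
      using rk_contraction[OF flat_subset[OF H]] by simp
    then have "Z_poly (contraction M H) = rv (rk M - r H) (Z_poly (contraction M H))"
      using kl_degree_Z_poly[OF matroid_contraction[OF flat_subset[OF H]] loopless_contraction[OF H]]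
      by simp
    \<comment> \<open>Reversal at the rank of the contraction cancels the factor x^(r G - r F) in
      front of each summand, so that the summand depends on H only through the Moebius
      value.\<close>
    also have "\<dots> = (\<Sum>F | F \<in> flats M \<and> H \<subseteq> F. rv (rk M - r F) (kl (contraction M F)))"
      unfolding Z_poly_contraction[OF H] rv_sum
      using rank_flat_mono_diff[OF _ flat_subset] by (intro sum.cong refl) (auto simp: rv_monom_mult)
    finally show "[:\<mu> H:] * Z_poly (contraction M H) =
        (\<Sum>F | F \<in> flats M \<and> H \<subseteq> F. [:\<mu> H:] * rv (rk M - r F) (kl (contraction M F)))"
      by (simp only: sum_distrib_left)
  qed
  also have "\<dots> = (\<Sum>F\<in>flats M. \<Sum>H | H \<in> flats M \<and> H \<subseteq> F.
        [:\<mu> H:] * rv (rk M - r F) (kl (contraction M F)))"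
    by (rule sum.swap_restrict) auto
  also have "\<dots> = (\<Sum>F\<in>flats M. if F = {} then rv (rk M) (kl M) else 0)"
  proof (intro sum.cong refl)
    fix F assume F: "F \<in> flats M"
    have "(\<Sum>H | H \<in> flats M \<and> H \<subseteq> F. [:\<mu> H:]) = [:if F = {} then 1 else 0:]"
      using sum_moebius[of F "{}" "flats M"] F empty_flat[OF assms]
        finite_subset[OF flat_subset[OF F] finite_ground]
      by (auto simp: \<mu>_def sum_const_poly)
    then show "(\<Sum>H | H \<in> flats M \<and> H \<subseteq> F. [:\<mu> H:] * rv (rk M - r F) (kl (contraction M F))) =
        (if F = {} then rv (rk M) (kl M) else 0)"
      by (simp only: sum_distrib_right[symmetric]) (auto simp: contraction_empty one_pCons[symmetric])
  qed
  also have "\<dots> = rv (rk M) (kl M)"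
    using empty_flat[OF assms] by (simp add: sum.delta)
  finally show ?thesis ..
qed

end

lemma degree_kl_le:
  assumes "is_matroid M" and "loopless M"
  shows "degree (kl M) \<le> rk M"
  using kl_degree_Z_poly[OF assms] by (cases "rk M = 0") (auto simp: kl_rk_0)

lemma KL_assignment_kl: "KL_assignment kl"
  unfolding KL_assignment_def
proof (intro allI impI)
  fix M :: "'a matroid"
  assume M: "is_matroid M \<and> loopless M"
  then interpret finite_matroid M by unfold_locales simp
  have "2 * degree (kl M) < rk M" if "0 < rk M"
    using kl_degree_Z_poly[of M] M that by simp
  moreover have "monom 1 (rk M - degree (kl M)) * reflect_poly (kl M) = rv (rk M) (kl M)"
    using M by (intro rv_eq_reflect_poly degree_kl_le) auto
  ultimately show "(rk M = 0 \<longrightarrow> kl M = 1) \<and> (rk M > 0 \<longrightarrow> real (degree (kl M)) < real (rk M) / 2) \<and>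
        monom 1 (rk M - degree (kl M)) * reflect_poly (kl M) =
          (\<Sum>F\<in>flats M. char_poly (restriction M F) * kl (contraction M F))"
    using M kl_recursion by (auto simp: kl_rk_0)
qed

section \<open>Uniqueness of the assignment\<close>

context finite_matroid
begin

lemma char_poly_restriction_empty:
  assumes "loopless M"
  shows "char_poly (restriction M {}) = 1"
proof -
  have "{H. H \<in> flats M \<and> H \<subseteq> {}} = {{}}"
    using empty_flat[OF assms] by auto
  then show ?thesis
    using empty_flat[OF assms] by (simp add: char_poly_restriction moebius.simps monom_0 one_pCons)
qed

end

text \<open>In the recursion only the flat {} involves the value at \<open>M\<close>, with
  coefficient 1. The other summands are known by induction, so the recursion prescribes
  \<open>rv (rk M) (Q M) - Q M\<close>, and \<open>rv_eqI\<close> applies.\<close>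

lemma KL_assignment_unique:
  assumes Q: "KL_assignment Q" and "is_matroid M" and "loopless M"
  shows "Q M = kl M"
  using assms(2,3)
proof (induction "card (ground M)" arbitrary: M rule: less_induct)
  case less
  interpret finite_matroid M using less by unfold_locales
  have *: "2 * degree (P M) < rk M \<and>
      rv (rk M) (P M) - P M = (\<Sum>F\<in>flats M - {{}}. char_poly (restriction M F) * P (contraction M F))"
    if P: "KL_assignment P" and "rk M \<noteq> 0" for P
  proof -
    have deg: "2 * degree (P M) < rk M" and
      rec: "monom 1 (rk M - degree (P M)) * reflect_poly (P M) =
          (\<Sum>F\<in>flats M. char_poly (restriction M F) * P (contraction M F))"
      using P less.prems that(2) by (auto simp: KL_assignment_def)
    moreover have "(\<Sum>F\<in>flats M. char_poly (restriction M F) * P (contraction M F)) =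
        P M + (\<Sum>F\<in>flats M - {{}}. char_poly (restriction M F) * P (contraction M F))"
      using empty_flat[OF less.prems(2)]
      by (subst sum.remove[where x = "{}"])
        (auto simp: contraction_empty char_poly_restriction_empty[OF less.prems(2)])
    ultimately show ?thesis
      using rv_eq_reflect_poly[of "P M" "rk M"] by simp
  qed
  show ?case
  proof (cases "rk M = 0")
    case True
    then show ?thesis
      using Q less.prems by (simp add: KL_assignment_def kl_rk_0)
  next
    case False
    have "Q (contraction M F) = kl (contraction M F)" if F: "F \<in> flats M - {{}}" for F
    proof -
      have "F \<subseteq> ground M" and "F \<noteq> {}" using F flat_subset by auto
      then have "card (ground (contraction M F)) < card (ground M)"
        by (auto intro!: psubset_card_mono)
      then show ?thesis
        using less.hyps F matroid_contraction flat_subset loopless_contraction by simp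
    qed
    then have "rv (rk M) (Q M) - Q M = rv (rk M) (kl M) - kl M"
      using *[OF Q False] *[OF KL_assignment_kl False] by simp
    then show ?thesis
      using *[OF Q False] *[OF KL_assignment_kl False] rv_eqI by blast
  qed
qed

lemma KL_poly_eq_kl:
  assumes "is_matroid M" and "loopless M"
  shows "KL_poly M = kl M"
  unfolding KL_poly_def
  using KL_assignment_kl KL_assignment_unique[OF _ assms] by (intro the_equality) auto

section \<open>The graphic matroid of the complete tripartite graph with parts 1, 1, n\<close>

definition spine :: "nat set" where "spine = {0, 1}"
definition lspoke :: "nat \<Rightarrow> nat set" where "lspoke i = {0, i}"
definition rspoke :: "nat \<Rightarrow> nat set" where "rspoke i = {1, i}"

text \<open>The bound 2 \<le> i excludes the coincidences
  \<open>lspoke 1 = rspoke 0 = spine\<close>.\<close>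

lemma edge_eq_iff [simp]:
  "lspoke i = lspoke j \<longleftrightarrow> i = j"
  "rspoke i = rspoke j \<longleftrightarrow> i = j"
  "2 \<le> i \<Longrightarrow> lspoke i \<noteq> rspoke j"
  "2 \<le> i \<Longrightarrow> rspoke j \<noteq> lspoke i"
  "2 \<le> i \<Longrightarrow> lspoke i \<noteq> spine"
  "2 \<le> i \<Longrightarrow> rspoke i \<noteq> spine"
  "2 \<le> i \<Longrightarrow> spine \<noteq> lspoke i"
  "2 \<le> i \<Longrightarrow> spine \<noteq> rspoke i"
  by (auto simp: spine_def lspoke_def rspoke_def doubleton_eq_iff)

text \<open>The rank of an edge set \<open>X\<close>, and whether it is independent, depend only on
  \<open>touched X\<close>, \<open>doubled X\<close> and the presence of \<open>spine\<close>: a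
  doubled vertex is a path from 0 to 1, just as the spine is.\<close>

definition touched :: "nat set set \<Rightarrow> nat set" where
  "touched X = {i. 2 \<le> i \<and> (lspoke i \<in> X \<or> rspoke i \<in> X)}"

definition doubled :: "nat set set \<Rightarrow> nat set" where
  "doubled X = {i. 2 \<le> i \<and> lspoke i \<in> X \<and> rspoke i \<in> X}"

lemma K11_eq: "K11 n = insert spine (lspoke ` {2..<n + 2} \<union> rspoke ` {2..<n + 2})"
proof (intro equalityI subsetI)
  fix e assume "e \<in> insert spine (lspoke ` {2..<n + 2} \<union> rspoke ` {2..<n + 2})"
  then show "e \<in> K11 n"
    unfolding K11_def complete_tripartite_def spine_def lspoke_def rspoke_def by blast
qed (auto simp: K11_def complete_tripartite_def spine_def lspoke_def rspoke_def)

lemma finite_K11: "finite (K11 n)"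
  by (simp add: K11_eq)

lemma touched_mono: "X \<subseteq> Y \<Longrightarrow> touched X \<subseteq> touched Y"
  by (auto simp: touched_def)

lemma doubled_mono: "X \<subseteq> Y \<Longrightarrow> doubled X \<subseteq> doubled Y"
  by (auto simp: doubled_def)

lemma doubled_subset_touched: "doubled X \<subseteq> touched X"
  by (auto simp: doubled_def touched_def)

lemma touched_K11: "X \<subseteq> K11 n \<Longrightarrow> touched X \<subseteq> {2..<n + 2}"
  by (auto simp: touched_def K11_eq)

lemma finite_touched: "X \<subseteq> K11 n \<Longrightarrow> finite (touched X)"
  by (rule finite_subset[OF touched_K11]) auto

lemma finite_doubled: "X \<subseteq> K11 n \<Longrightarrow> finite (doubled X)"
  by (rule finite_subset[OF doubled_subset_touched finite_touched])

lemma card_K11_subset: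
  assumes X: "X \<subseteq> K11 n"
  shows "card X = card (touched X) + card (doubled X) + of_bool (spine \<in> X)"
proof -
  define A where "A = {i. 2 \<le> i \<and> lspoke i \<in> X}"
  define B where "B = {i. 2 \<le> i \<and> rspoke i \<in> X}"
  have sub: "A \<subseteq> touched X" "B \<subseteq> touched X"
    by (auto simp: A_def B_def touched_def)
  then have fin: "finite A" "finite B"
    using finite_touched[OF X] finite_subset by auto
  have X_eq: "X = (if spine \<in> X then {spine} else {}) \<union> (lspoke ` A \<union> rspoke ` B)"
    using X by (auto simp: A_def B_def K11_eq)
  have "card X = of_bool (spine \<in> X) + (card (lspoke ` A) + card (rspoke ` B))"
    by (subst X_eq, subst card_Un_disjoint, use fin in \<open>auto simp: A_def B_def\<close>)
      (subst card_Un_disjoint, use fin in \<open>auto simp: A_def B_def\<close>)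
  also have "card (lspoke ` A) = card A"
    by (rule card_image) (auto simp: inj_on_def)
  also have "card (rspoke ` B) = card B"
    by (rule card_image) (auto simp: inj_on_def)
  also have "card A + card B = card (A \<union> B) + card (A \<inter> B)"
    using fin by (rule card_Un_Int)
  also have "A \<union> B = touched X" by (auto simp: A_def B_def touched_def)
  also have "A \<inter> B = doubled X" by (auto simp: A_def B_def doubled_def)
  finally show ?thesis by simp
qed

lemma graph_cycle_triangle:
  assumes "spine \<in> X" and "i \<in> doubled X"
  shows "graph_cycle X [0, 1, i]"
proof -
  have edges: "{0, 1} \<in> X" "{1, i} \<in> X" "{i, 0} \<in> X" "2 \<le> i"
    using assms by (simp_all add: doubled_def spine_def lspoke_def rspoke_def insert_commute)
  then have "{[0, 1, i] ! k, [0, 1, i] ! (Suc k mod 3)} \<in> X" if "k < 3" for k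
  proof -
    have "k = 0 \<or> k = 1 \<or> k = 2" using that by arith
    then show ?thesis using edges by (elim disjE) simp_all
  qed
  then show ?thesis
    using \<open>2 \<le> i\<close> by (simp add: graph_cycle_def)
qed

lemma graph_cycle_square:
  assumes "i \<in> doubled X" and "j \<in> doubled X" and "i \<noteq> j"
  shows "graph_cycle X [0, i, 1, j]"
proof -
  have edges: "{0, i} \<in> X" "{i, 1} \<in> X" "{1, j} \<in> X" "{j, 0} \<in> X" "2 \<le> i" "2 \<le> j"
    using assms by (simp_all add: doubled_def lspoke_def rspoke_def insert_commute)
  then have "{[0, i, 1, j] ! k, [0, i, 1, j] ! (Suc k mod 4)} \<in> X" if "k < 4" for k
  proof -
    have "k = 0 \<or> k = 1 \<or> k = 2 \<or> k = 3" using that by arith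
    then show ?thesis using edges by (elim disjE) simp_all
  qed
  then show ?thesis
    using \<open>2 \<le> i\<close> \<open>2 \<le> j\<close> \<open>i \<noteq> j\<close> by (simp add: graph_cycle_def)
qed

lemma K11_neighbour: "{u, v} \<in> K11 n \<Longrightarrow> 2 \<le> v \<Longrightarrow> u = 0 \<or> u = 1"
  by (auto simp: K11_def complete_tripartite_def doubleton_eq_iff)

text \<open>The neighbours on a cycle of a vertex of the part of size \<open>n\<close> are \<open>0\<close> and \<open>1\<close>.\<close>

lemma graph_cycle_doubled:
  assumes X: "X \<subseteq> K11 n" and cyc: "graph_cycle X vs" and v: "v \<in> set vs" "2 \<le> v"
  shows "v \<in> doubled X"
proof -
  define k where "k = length vs"
  have k: "3 \<le> k" and dist: "distinct vs"
    and edge: "\<And>i. i < k \<Longrightarrow> {vs ! i, vs ! (Suc i mod k)} \<in> X"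
    using cyc by (auto simp: graph_cycle_def k_def)
  obtain i where i: "i < k" "v = vs ! i"
    using v by (auto simp: in_set_conv_nth k_def)
  define s where "s = Suc i mod k"
  define p where "p = (if i = 0 then k - 1 else i - 1)"
  have s: "s < k" and p: "p < k" "Suc p mod k = i"
    using k i by (auto simp: s_def p_def)
  \<comment> \<open>A cycle has at least three vertices, so successor and predecessor of
    \<open>v\<close> differ; both lie in {0, 1}, hence \<open>v\<close> is joined to 0 and to
    1.\<close>
  have "s \<noteq> p"
    using k i by (cases "Suc i = k") (auto simp: s_def p_def)
  then have neq: "vs ! s \<noteq> vs ! p"
    using dist s p by (simp add: nth_eq_iff_index_eq k_def)
  have es: "{vs ! s, v} \<in> X"
    using edge[OF i(1)] i(2) by (simp add: s_def insert_commute)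
  moreover have ep: "{vs ! p, v} \<in> X"
    using edge[OF p(1)] i(2) p(2) by simp
  ultimately have "vs ! s = 0 \<or> vs ! s = 1" "vs ! p = 0 \<or> vs ! p = 1"
    using X K11_neighbour v(2) by blast+
  then show ?thesis
    using neq es ep v(2) by (auto simp: doubled_def lspoke_def rspoke_def)
qed

text \<open>The spine and the doubled vertices give internally disjoint paths from 0 to 1. Two of
  them form a triangle or a square, and every cycle arises in this way.\<close>

lemma graph_cycle_K11_iff:
  assumes X: "X \<subseteq> K11 n"
  shows "(\<exists>vs. graph_cycle X vs) \<longleftrightarrow> 2 \<le> card (doubled X) + of_bool (spine \<in> X)"
proof
  assume "\<exists>vs. graph_cycle X vs"
  then obtain vs where cyc: "graph_cycle X vs" ..
  have k: "3 \<le> length vs" and dist: "distinct vs"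
    using cyc by (auto simp: graph_cycle_def)
  have sub: "set vs \<subseteq> {0, 1} \<union> doubled X"
  proof
    fix v assume "v \<in> set vs"
    then show "v \<in> {0, 1} \<union> doubled X"
      using graph_cycle_doubled[OF X cyc, of v] by (cases "2 \<le> v") auto
  qed
  have cs: "card (set vs) = length vs"
    using dist by (rule distinct_card)
  have le: "card (set vs) \<le> card ({0, 1} \<union> doubled X)"
    using sub finite_doubled[OF X] by (intro card_mono) auto
  have cd: "card ({0, 1} \<union> doubled X) \<le> 2 + card (doubled X)"
    using card_Un_le[of "{0::nat, 1}" "doubled X"] by simp
  show "2 \<le> card (doubled X) + of_bool (spine \<in> X)"
  proof (rule ccontr)
    \<comment> \<open>With at most one such path, counting vertices forces a triangle on 0, 1 and a
      doubled vertex; but a triangle through 0 and 1 contains the spine.\<close>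
    assume neg: "\<not> ?thesis"
    then have one: "card (doubled X) = 1" and e: "spine \<notin> X"
      using k cs le cd by (auto split: if_splits)
    have len: "length vs = 3"
      using k cs le cd one by linarith
    have "set vs = {0, 1} \<union> doubled X"
      using sub finite_doubled[OF X] len cs cd one by (intro card_seteq) auto
    then have "0 \<in> set vs" "1 \<in> set vs" by auto
    then obtain i j where "i < 3" "vs ! i = 0" "j < 3" "vs ! j = 1"
      using len by (auto simp: in_set_conv_nth)
    moreover have "\<And>i. i < 3 \<Longrightarrow> {vs ! i, vs ! (Suc i mod 3)} \<in> X"
      using cyc len by (auto simp: graph_cycle_def)
    from this[of 0] this[of 1] this[of 2]
    have "{vs ! 0, vs ! 1} \<in> X" "{vs ! 1, vs ! 2} \<in> X" "{vs ! 2, vs ! 0} \<in> X"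
      by (auto simp: numeral_2_eq_2)
    ultimately show False
      using e by (auto simp: spine_def less_Suc_eq numeral_3_eq_3 numeral_2_eq_2 insert_commute)
  qed
next
  assume ge: "2 \<le> card (doubled X) + of_bool (spine \<in> X)"
  show "\<exists>vs. graph_cycle X vs"
  proof (cases "spine \<in> X")
    case True
    then obtain i where "i \<in> doubled X"
      using ge by (cases "doubled X = {}") auto
    then show ?thesis using graph_cycle_triangle True by blast
  next
    case False
    then have "\<not> card (doubled X) \<le> Suc 0" using ge by simp
    then obtain i j where "i \<in> doubled X" "j \<in> doubled X" "i \<noteq> j"
      using finite_doubled[OF X] by (auto simp: card_le_Suc0_iff_eq)
    then show ?thesis using graph_cycle_square by blast
  qed
qed

section \<open>Independent sets, rank and flats\<close>

abbreviation thag :: "nat \<Rightarrow> nat set matroid" where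
  "thag n \<equiv> graphic_matroid (K11 n)"

lemma ground_thag [simp]: "ground (thag n) = K11 n"
  by (simp add: graphic_matroid_def)

lemma indeps_thag:
  "X \<in> indeps (thag n) \<longleftrightarrow> X \<subseteq> K11 n \<and> card (doubled X) + of_bool (spine \<in> X) \<le> 1"
  using graph_cycle_K11_iff[of X n] by (auto simp: graphic_matroid_def not_le)

lemma touched_insert [simp]:
  "touched (insert spine X) = touched X"
  "2 \<le> i \<Longrightarrow> touched (insert (lspoke i) X) = insert i (touched X)"
  "2 \<le> i \<Longrightarrow> touched (insert (rspoke i) X) = insert i (touched X)"
  by (auto simp: touched_def)

lemma doubled_insert [simp]:
  "doubled (insert spine X) = doubled X"
  "2 \<le> i \<Longrightarrow> doubled (insert (lspoke i) X) = (if rspoke i \<in> X then insert i (doubled X) else doubled X)"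
  "2 \<le> i \<Longrightarrow> doubled (insert (rspoke i) X) = (if lspoke i \<in> X then insert i (doubled X) else doubled X)"
  by (auto simp: doubled_def)

lemma spoke_touched_not_doubled:
  "i \<in> touched X \<Longrightarrow> i \<notin> doubled X \<Longrightarrow> lspoke i \<in> X \<and> rspoke i \<notin> X \<or> lspoke i \<notin> X \<and> rspoke i \<in> X"
  by (auto simp: touched_def doubled_def)

text \<open>If \<open>J\<close> touches a vertex that \<open>I\<close> does not, a spoke at that
  vertex can be added safely. Otherwise the count in \<open>card_K11_subset\<close> shows that
  \<open>I\<close> has no path from 0 to 1 while \<open>J\<close> has one; adding the spine, or the
  missing spoke at a vertex doubled in \<open>J\<close>, creates the single path that is
  allowed.\<close>

lemma thag_exchange:
  assumes I: "I \<in> indeps (thag n)" and J: "J \<in> indeps (thag n)" and lt: "card I < card J"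
  shows "\<exists>e\<in>J - I. insert e I \<in> indeps (thag n)"
proof (cases "touched J \<subseteq> touched I")
  case False
  then obtain i where i: "i \<in> touched J" "i \<notin> touched I" by blast
  then obtain e where "e \<in> J" "e = lspoke i \<or> e = rspoke i" "2 \<le> i"
    by (auto simp: touched_def)
  moreover have "lspoke i \<notin> I" "rspoke i \<notin> I"
    using i(2) \<open>2 \<le> i\<close> by (auto simp: touched_def)
  ultimately show ?thesis
    using I J by (intro bexI[of _ e]) (auto simp: indeps_thag)
next
  case True
  have X: "I \<subseteq> K11 n" "J \<subseteq> K11 n" using I J by (auto simp: indeps_thag)
  then have "card (touched J) \<le> card (touched I)"
    using True finite_touched by (intro card_mono)
  then have "card (doubled I) + of_bool (spine \<in> I) < card (doubled J) + of_bool (spine \<in> J)"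
    using lt card_K11_subset X by fastforce
  moreover have "card (doubled J) + of_bool (spine \<in> J) \<le> 1"
    using J by (simp add: indeps_thag)
  ultimately have "card (doubled I) + of_bool (spine \<in> I) = 0" "card (doubled J) + of_bool (spine \<in> J) \<noteq> 0"
    by linarith+
  then have dI: "doubled I = {}" "spine \<notin> I" and dJ: "spine \<in> J \<or> doubled J \<noteq> {}"
    using finite_doubled[OF X(1)] by auto
  show ?thesis
  proof (cases "spine \<in> J")
    case True
    then show ?thesis
      using dI I J by (intro bexI[of _ spine]) (auto simp: indeps_thag)
  next
    case False
    then obtain j where j: "j \<in> doubled J" using dJ by auto
    then have "j \<in> touched I" "j \<notin> doubled I"
      using True doubled_subset_touched dI by auto
    moreover have "2 \<le> j" "lspoke j \<in> J" "rspoke j \<in> J"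
      using j by (auto simp: doubled_def)
    moreover have "lspoke j \<in> K11 n" "rspoke j \<in> K11 n"
      using calculation X by auto
    ultimately have "\<exists>e\<in>{lspoke j, rspoke j}. e \<in> J - I \<and> insert e I \<in> indeps (thag n)"
      using spoke_touched_not_doubled[of j I] dI X by (auto simp: indeps_thag)
    then show ?thesis by blast
  qed
qed

lemma matroid_thag: "is_matroid (thag n)"
proof -
  have mono: "J \<in> indeps (thag n)" if I: "I \<in> indeps (thag n)" and J: "J \<subseteq> I" for I J
  proof -
    have "card (doubled J) \<le> card (doubled I)"
      using I J doubled_mono finite_doubled[of I] by (intro card_mono) (auto simp: indeps_thag)
    moreover have "of_bool (spine \<in> J) \<le> (of_bool (spine \<in> I) :: nat)"
      using J by auto
    ultimately show ?thesis
      using I J unfolding indeps_thag by (meson add_mono le_trans subset_trans)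
  qed
  have "{} \<in> indeps (thag n)"
    by (simp add: indeps_thag doubled_def)
  moreover have "indeps (thag n) \<subseteq> Pow (K11 n)"
    by (auto simp: indeps_thag)
  ultimately show ?thesis
    using mono thag_exchange[of _ n] finite_K11 unfolding is_matroid_def ground_thag
    by (intro conjI ballI allI impI)
qed

lemma loopless_thag: "loopless (thag n)"
proof -
  have "doubled {e} = {}" for e
    using edge_eq_iff(3) by (auto simp: doubled_def)
  then show ?thesis
    by (auto simp: loopless_def indeps_thag)
qed

interpretation thag: finite_matroid "thag n" for n
  by unfold_locales (rule matroid_thag)

lemma rank_thag:
  assumes X: "X \<subseteq> K11 n"
  shows "rank_of (thag n) X = card (touched X) + of_bool (spine \<in> X \<or> doubled X \<noteq> {})"
proof (rule order_antisym)
  obtain I where I: "I \<in> indeps (thag n)" "I \<subseteq> X" "card I = rank_of (thag n) X"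
    using thag.basis_exists by blast
  then have "card (touched I) \<le> card (touched X)"
    using touched_mono finite_touched[OF X] by (intro card_mono)
  moreover have "card (doubled I) + of_bool (spine \<in> I) \<le>
      (of_bool (spine \<in> X \<or> doubled X \<noteq> {}) :: nat)"
    using I doubled_mono[OF I(2)] by (auto simp: indeps_thag)
  ultimately show "rank_of (thag n) X \<le> card (touched X) + of_bool (spine \<in> X \<or> doubled X \<noteq> {})"
    using card_K11_subset[of I n] I X by (simp add: indeps_thag)
next
  \<comment> \<open>One spoke per touched vertex, the left one if available. So \<open>J\<close>
    contains no path from 0 to 1, and for a doubled vertex j the spoke \<open>rspoke j\<close> is
    still free to create one.\<close>
  define J where "J = (\<lambda>i. if lspoke i \<in> X then lspoke i else rspoke i) ` touched X"
  have J: "J \<subseteq> X" by (auto simp: J_def touched_def)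
  have spokes: "lspoke i \<in> J \<longleftrightarrow> lspoke i \<in> X" "rspoke i \<in> J \<longleftrightarrow> lspoke i \<notin> X \<and> rspoke i \<in> X" if "2 \<le> i" for i
    using that by (auto simp: J_def touched_def)
  have tJ: "touched J = touched X" "doubled J = {}"
    using spokes by (auto simp: touched_def doubled_def)
  have eJ: "spine \<notin> J"
    by (auto simp: J_def touched_def)
  have lower: "card (touched X) + 1 \<le> rank_of (thag n) X"
    if e: "e \<in> X" "touched (insert e J) = touched X"
      "card (doubled (insert e J)) + of_bool (spine \<in> insert e J) = 1" for e
  proof -
    have sub: "insert e J \<subseteq> X" using e J by auto
    then have "insert e J \<subseteq> K11 n" using X by (rule subset_trans)
    then have "card (insert e J) = card (touched X) + 1" "insert e J \<in> indeps (thag n)"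
      using card_K11_subset[of "insert e J" n] e by (auto simp: indeps_thag simp del: insert_subset)
    then show ?thesis
      using thag.indep_card_le_rank[of "insert e J" n X] sub by simp
  qed
  show "card (touched X) + of_bool (spine \<in> X \<or> doubled X \<noteq> {}) \<le> rank_of (thag n) X"
  proof (cases "spine \<in> X \<or> doubled X \<noteq> {}")
    case True
    then consider "spine \<in> X" | j where "j \<in> doubled X" by auto
    then show ?thesis
    proof cases
      case 1
      then show ?thesis
        using lower[of spine] tJ by simp
    next
      case (2 j)
      then have "2 \<le> j" "lspoke j \<in> X" "rspoke j \<in> X" "j \<in> touched X"
        by (auto simp: doubled_def touched_def)
      then show ?thesis
        using lower[of "rspoke j"] tJ eJ spokes True by (auto simp: insert_absorb)
    qed
  next
    case False
    then show ?thesis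
      using thag.indep_card_le_rank[of J n X] card_K11_subset[of J n] J X tJ eJ
      by (auto simp: indeps_thag)
  qed
qed

text \<open>Once 0 and 1 are joined, one spoke at a vertex spans the other; and a doubled vertex
  spans the spine. These are the only closure conditions.\<close>

lemma flats_thag:
  "X \<in> flats (thag n) \<longleftrightarrow> X \<subseteq> K11 n \<and>
     (if spine \<in> X then touched X \<subseteq> doubled X else doubled X = {})"
proof (cases "X \<subseteq> K11 n")
  case X: True
  have ins: "rank_of (thag n) (insert e X) =
      card (touched (insert e X)) + of_bool (spine \<in> insert e X \<or> doubled (insert e X) \<noteq> {})"
    if "e \<in> K11 n" for e
    using rank_thag[of "insert e X" n] X that by simp
  have spoke: "lspoke i \<in> K11 n" "rspoke i \<in> K11 n" if "i \<in> touched X" for i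
    using touched_K11[OF X] that by (auto simp: K11_eq)
  note fin = finite_touched[OF X]
  show ?thesis
  proof
    assume F: "X \<in> flats (thag n)"
    have less: "card (touched X) + of_bool (spine \<in> X \<or> doubled X \<noteq> {}) <
        card (touched (insert e X)) + of_bool (spine \<in> insert e X \<or> doubled (insert e X) \<noteq> {})"
      if "e \<in> K11 n" "e \<notin> X" for e
      using F that ins rank_thag[OF X] by (auto simp: flats_def)
    have "touched X \<subseteq> doubled X" if "spine \<in> X"
    proof
      fix i assume i: "i \<in> touched X"
      then have "2 \<le> i" by (simp add: touched_def)
      then show "i \<in> doubled X"
        using less[OF spoke(1)[OF i]] less[OF spoke(2)[OF i]] i that
        by (auto simp: doubled_def insert_absorb)
    qed
    moreover have "doubled X = {}" if "spine \<notin> X"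
      using less[of spine] that by (auto simp: K11_eq)
    ultimately show "X \<subseteq> K11 n \<and> (if spine \<in> X then touched X \<subseteq> doubled X else doubled X = {})"
      using X by auto
  next
    assume R: "X \<subseteq> K11 n \<and> (if spine \<in> X then touched X \<subseteq> doubled X else doubled X = {})"
    have "rank_of (thag n) X < rank_of (thag n) (insert e X)" if e: "e \<in> K11 n" "e \<notin> X" for e
    proof -
      consider "e = spine" | i where "2 \<le> i" "e = lspoke i" | i where "2 \<le> i" "e = rspoke i"
        using e(1) by (auto simp: K11_eq)
      then show ?thesis
      proof cases
        case 1
        then show ?thesis
          using e R by (auto simp: ins rank_thag[OF X])
      next
        case (2 i)
        have "i \<notin> doubled X" using 2 e by (auto simp: doubled_def)
        then have "i \<in> touched X \<Longrightarrow> spine \<notin> X \<and> rspoke i \<in> X"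
          using R 2 e by (auto split: if_splits simp: touched_def)
        then show ?thesis
          using e R 2 fin by (cases "i \<in> touched X") (auto simp: ins rank_thag[OF X] insert_absorb)
      next
        case (3 i)
        have "i \<notin> doubled X" using 3 e by (auto simp: doubled_def)
        then have "i \<in> touched X \<Longrightarrow> spine \<notin> X \<and> lspoke i \<in> X"
          using R 3 e by (auto split: if_splits simp: touched_def)
        then show ?thesis
          using e R 3 fin by (cases "i \<in> touched X") (auto simp: ins rank_thag[OF X] insert_absorb)
      qed
    qed
    then show "X \<in> flats (thag n)"
      using X by (auto simp: flats_def)
  qed
qed (auto simp: flats_def)

lemma rk_thag: "rk (thag n) = n + 1"
proof -
  have "touched (K11 n) = {2..<n + 2}"
    by (auto simp: touched_def K11_eq)
  moreover have "spine \<in> K11 n"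
    by (simp add: K11_eq)
  ultimately show ?thesis
    using rank_thag[of "K11 n" n] by (simp add: rk_def)
qed

lemma rank_flat_thag:
  assumes "F \<in> flats (thag n)"
  shows "rank_of (thag n) F = card (touched F) + of_bool (spine \<in> F)"
  using assms rank_thag[of F n] by (simp add: flats_thag split: if_splits)

section \<open>Sums over the flats above a given flat\<close>

definition full_fan :: "nat set \<Rightarrow> nat set set" where
  "full_fan S = insert spine (lspoke ` S \<union> rspoke ` S)"

lemma flat_eq_full_fan:
  assumes "G \<in> flats (thag n)" and "spine \<in> G"
  shows "full_fan (touched G) = G"
proof (intro equalityI subsetI)
  fix e assume e: "e \<in> G"
  then have "e \<in> K11 n" using assms by (auto simp: flats_thag)
  then show "e \<in> full_fan (touched G)"
    using e by (auto simp: full_fan_def K11_eq touched_def)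
qed (use assms in \<open>auto simp: full_fan_def flats_thag doubled_def\<close>)

lemma touched_full_fan: "S \<subseteq> {2..<n + 2} \<Longrightarrow> touched (full_fan S) = S"
  by (auto simp: full_fan_def touched_def)

lemma flat_full_fan:
  assumes "S \<subseteq> {2..<n + 2}"
  shows "full_fan S \<in> flats (thag n)"
proof -
  have "full_fan S \<subseteq> K11 n"
    using assms by (auto simp: full_fan_def K11_eq)
  then show ?thesis
    using assms unfolding flats_thag touched_full_fan[OF assms]
    by (auto simp: full_fan_def doubled_def)
qed

text \<open>A flat containing the spine is the full fan over its touched vertices, so a larger one
  is given by the set \<open>S\<close> of newly touched vertices.\<close>

lemma sum_flats_spine:
  assumes F: "F \<in> flats (thag n)"
  shows "(\<Sum>G | G \<in> flats (thag n) \<and> F \<subseteq> G \<and> spine \<in> G. g (card (touched G))) =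
    (\<Sum>S\<in>Pow ({2..<n + 2} - touched F). g (card (touched F) + card S))"
proof (rule sum.reindex_bij_witness
    [where j = "\<lambda>G. touched G - touched F" and i = "\<lambda>S. full_fan (touched F \<union> S)"])
  have tF: "touched F \<subseteq> {2..<n + 2}" and FK: "F \<subseteq> K11 n"
    using F touched_K11 by (auto simp: flats_thag)
  fix G assume G: "G \<in> {G. G \<in> flats (thag n) \<and> F \<subseteq> G \<and> spine \<in> G}"
  then have sub: "touched F \<subseteq> touched G" "touched G \<subseteq> {2..<n + 2}"
    using touched_mono touched_K11 by (auto simp: flats_thag)
  then show "full_fan (touched F \<union> (touched G - touched F)) = G"
    using flat_eq_full_fan[of G n] G by (simp add: Un_absorb1)
  show "touched G - touched F \<in> Pow ({2..<n + 2} - touched F)"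
    using sub by auto
  have "finite (touched G)" using sub(2) finite_subset by blast
  then show "g (card (touched F) + card (touched G - touched F)) = g (card (touched G))"
    using sub(1) card_mono[of "touched G" "touched F"] finite_subset[of "touched F" "touched G"]
    by (simp add: card_Diff_subset)
next
  have tF: "touched F \<subseteq> {2..<n + 2}" and FK: "F \<subseteq> K11 n"
    using F touched_K11 by (auto simp: flats_thag)
  fix S assume S: "S \<in> Pow ({2..<n + 2} - touched F)"
  then have sub: "touched F \<union> S \<subseteq> {2..<n + 2}" using tF by auto
  then show "touched (full_fan (touched F \<union> S)) - touched F = S"
    using S by (auto simp: touched_full_fan)
  have "F \<subseteq> full_fan (touched F)"
    using FK by (auto simp: full_fan_def K11_eq touched_def)
  then have "F \<subseteq> full_fan (touched F \<union> S)"
    by (auto simp: full_fan_def)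
  then show "full_fan (touched F \<union> S) \<in> {G. G \<in> flats (thag n) \<and> F \<subseteq> G \<and> spine \<in> G}"
    using flat_full_fan[OF sub] by (auto simp: full_fan_def)
qed

text \<open>Above \<open>F\<close>, such a flat selects a set \<open>S\<close> of new vertices and,
  for each of them, one of the two spokes; \<open>A\<close> is the set of those joined to 0. The
  summand does not depend on \<open>A\<close>, so the inner sum is a factor 2 ^ card S.\<close>

lemma sum_flats_no_spine:
  assumes F: "F \<in> flats (thag n)" and "spine \<notin> F"
  shows "(\<Sum>G | G \<in> flats (thag n) \<and> F \<subseteq> G \<and> spine \<notin> G. g (card (touched G))) =
    (\<Sum>S\<in>Pow ({2..<n + 2} - touched F). \<Sum>A\<in>Pow S. g (card (touched F) + card S))"
proof -
  have tF: "touched F \<subseteq> {2..<n + 2}" and FK: "F \<subseteq> K11 n" and dF: "doubled F = {}"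
    using F touched_K11[of F n] assms(2) by (auto simp: flats_thag)
  define U where "U = {2..<n + 2} - touched F"
  have fin: "finite S" if "S \<in> Pow U" for S
    using that finite_subset[of S "{2..<n + 2}"] by (auto simp: U_def)
  define ext where "ext = (\<lambda>(S, A). F \<union> (lspoke ` A \<union> rspoke ` (S - A)))"
  have "(\<Sum>G | G \<in> flats (thag n) \<and> F \<subseteq> G \<and> spine \<notin> G. g (card (touched G))) =
    (\<Sum>(S, A)\<in>Sigma (Pow U) Pow. g (card (touched F) + card S))"
  proof (rule sum.reindex_bij_witness
      [where j = "\<lambda>G. (touched G - touched F, {i \<in> touched G - touched F. lspoke i \<in> G})" and i = ext])
    fix G assume G: "G \<in> {G. G \<in> flats (thag n) \<and> F \<subseteq> G \<and> spine \<notin> G}"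
    then have GK: "G \<subseteq> K11 n" and dG: "doubled G = {}" and FG: "F \<subseteq> G" and sG: "spine \<notin> G"
      by (auto simp: flats_thag)
    have sub: "touched F \<subseteq> touched G" "touched G \<subseteq> {2..<n + 2}"
      using touched_mono[OF FG] touched_K11[OF GK] by auto
    have "G \<subseteq> ext (touched G - touched F, {i \<in> touched G - touched F. lspoke i \<in> G})"
    proof
      fix e assume e: "e \<in> G"
      then have "e \<in> K11 n" using GK by auto
      then obtain i where i: "2 \<le> i" "e = lspoke i \<or> e = rspoke i"
        using e sG by (auto simp: K11_eq)
      have ti: "i \<in> touched G" using e i by (auto simp: touched_def)
      have not2: "\<not> (lspoke i \<in> G \<and> rspoke i \<in> G)" using dG i(1) by (auto simp: doubled_def)
      show "e \<in> ext (touched G - touched F, {i \<in> touched G - touched F. lspoke i \<in> G})"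
      proof (cases "i \<in> touched F")
        case True
        then have "lspoke i \<in> F \<or> rspoke i \<in> F" by (simp add: touched_def)
        then have "e \<in> F" using e i FG not2 by auto
        then show ?thesis by (simp add: ext_def)
      next
        case False
        then show ?thesis using e i ti not2 by (auto simp: ext_def)
      qed
    qed
    moreover have "ext (touched G - touched F, {i \<in> touched G - touched F. lspoke i \<in> G}) \<subseteq> G"
      using FG by (auto simp: ext_def touched_def)
    ultimately show "ext (touched G - touched F, {i \<in> touched G - touched F. lspoke i \<in> G}) = G"
      by (rule antisym[rotated])
    show "(touched G - touched F, {i \<in> touched G - touched F. lspoke i \<in> G}) \<in> Sigma (Pow U) Pow"
      using sub by (auto simp: U_def)
    have "finite (touched G)" using sub(2) finite_subset by blast
    then show "(case (touched G - touched F, {i \<in> touched G - touched F. lspoke i \<in> G}) of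
        (S, A) \<Rightarrow> g (card (touched F) + card S)) = g (card (touched G))"
      using sub(1) card_mono[of "touched G" "touched F"] finite_subset[of "touched F" "touched G"]
      by (simp add: card_Diff_subset)
  next
    fix SA assume "SA \<in> Sigma (Pow U) Pow"
    then obtain S A where SA: "SA = (S, A)" "S \<subseteq> U" "A \<subseteq> S" by auto
    have ge2: "2 \<le> i" "i \<notin> touched F" "i < n + 2" if "i \<in> S" for i
      using SA(2) that by (auto simp: U_def)
    have ext: "ext SA \<subseteq> K11 n" "F \<subseteq> ext SA" "spine \<notin> ext SA"
      using FK assms(2) SA ge2 by (auto simp: ext_def K11_eq)
    have "\<And>j. j \<in> A \<Longrightarrow> rspoke i \<noteq> lspoke j" for i
      using SA ge2 by auto
    then have spokes: "lspoke i \<in> ext SA \<longleftrightarrow> lspoke i \<in> F \<or> i \<in> A"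
        "rspoke i \<in> ext SA \<longleftrightarrow> rspoke i \<in> F \<or> i \<in> S - A" if "2 \<le> i" for i
      using that SA by (auto simp: ext_def)
    have t: "touched (ext SA) = touched F \<union> S"
      using spokes ge2 SA(3) by (auto simp: touched_def)
    have "doubled (ext SA) = {}"
    proof -
      have "\<not> (lspoke i \<in> ext SA \<and> rspoke i \<in> ext SA)" if "2 \<le> i" for i
        using spokes[OF that] ge2[of i] SA(3) dF that by (auto simp: doubled_def touched_def)
      then show ?thesis by (auto simp: doubled_def)
    qed
    then show "ext SA \<in> {G. G \<in> flats (thag n) \<and> F \<subseteq> G \<and> spine \<notin> G}"
      using ext by (simp add: flats_thag)
    have "touched (ext SA) - touched F = S" using t SA(2) by (auto simp: U_def)
    moreover have "{i \<in> S. lspoke i \<in> ext SA} = A"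
      using spokes ge2 SA(3) by (auto simp: touched_def)
    ultimately show "(touched (ext SA) - touched F, {i \<in> touched (ext SA) - touched F. lspoke i \<in> ext SA}) = SA"
      using SA(1) by simp
  qed
  also have "\<dots> = (\<Sum>S\<in>Pow U. \<Sum>A\<in>Pow S. g (card (touched F) + card S))"
    using fin by (subst sum.Sigma) (auto simp: U_def)
  finally show ?thesis by (simp add: U_def)
qed

section \<open>Palindromicity determines the polynomials of all contractions\<close>

lemma sum_Pow_card:
  fixes h :: "nat \<Rightarrow> 'b::comm_semiring_1"
  assumes "finite U"
  shows "(\<Sum>S\<in>Pow U. h (card S)) = (\<Sum>k\<le>card U. of_nat (card U choose k) * h k)"
proof -
  have "(\<Sum>S\<in>Pow U. h (card S)) = (\<Sum>k\<le>card U. \<Sum>S | S \<in> Pow U \<and> card S = k. h (card S))"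
    using assms by (intro sum.group[symmetric]) (auto intro: card_mono)
  also have "\<dots> = (\<Sum>k\<le>card U. of_nat (card U choose k) * h k)"
    using assms by (intro sum.cong refl) (simp add: n_subsets)
  finally show ?thesis .
qed

text \<open>This is (1 + x)^u, the Z-polynomial of the Boolean matroid of rank u.\<close>

definition binomial_poly :: "nat \<Rightarrow> 'a::comm_ring_1 poly" where
  "binomial_poly u = (\<Sum>k\<le>u. monom (of_nat (u choose k)) k)"

lemma rv_binomial_poly: "rv u (binomial_poly u) = binomial_poly u"
  by (rule poly_eqI) (simp add: coeff_rv binomial_poly_def coeff_sum binomial_symmetric[symmetric])

text \<open>The Z-polynomial of K_{1,1,u} with \<open>p\<close> in place of the unknown polynomials.
  A flat without the spine has k vertices with one of two spokes each, and rank k; a flat with the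
  spine on k vertices has rank k + 1, and its contraction has polynomial 1.\<close>

definition thag_Z :: "(nat \<Rightarrow> 'a::comm_ring_1 poly) \<Rightarrow> nat \<Rightarrow> 'a poly" where
  "thag_Z p u =
    (\<Sum>k\<le>u. monom (of_nat (u choose k) * 2 ^ k) k * p (u - k)) + monom 1 1 * binomial_poly u"

lemma map_poly_of_int_sum:
  "map_poly of_int (\<Sum>x\<in>A. f x :: int poly) = (\<Sum>x\<in>A. map_poly of_int (f x) :: 'a::ring_1 poly)"
  by (rule poly_eqI) (simp add: coeff_map_poly coeff_sum)

lemma map_poly_of_int_monom_mult:
  "map_poly of_int (monom 1 k * p) = (monom 1 k * map_poly of_int p :: 'a::comm_ring_1 poly)"
  by (rule poly_eqI) (simp add: coeff_map_poly coeff_monom_mult)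

lemma map_poly_of_int_rv:
  "map_poly of_int (rv r p) = (rv r (map_poly of_int p) :: 'a::comm_ring_1 poly)"
  by (rule poly_eqI) (simp add: coeff_map_poly coeff_rv)

lemma of_nat_mult_monom: "of_nat a * monom b k = monom (of_nat a * b) k"
  by (simp add: of_nat_poly smult_monom)

text \<open>Contracting a flat without the spine merges each touched vertex with 0 or 1 and makes
  its other spoke parallel to the spine; once the spine is contracted, the two spokes at every
  remaining vertex are parallel, which gives a Boolean matroid up to simplification. Instead of
  invariance under isomorphism and simplification, the proof treats all flats of one fixed graph,
  from the large ones down.\<close>

theorem kl_thag_contraction:
  fixes p :: "nat \<Rightarrow> real poly"
  assumes deg: "\<And>u. 2 * degree (p u) \<le> u"
    and pal: "\<And>u. rv (u + 1) (thag_Z p u) = thag_Z p u"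
    and F: "F \<in> flats (thag n)"
  shows "map_poly of_int (kl (contraction (thag n) F)) =
    (if spine \<in> F then 1 else p (n - card (touched F)))"
  using F
proof (induction "card (K11 n - F)" arbitrary: F rule: less_induct)
  case less
  note F = less.prems
  define W where "W G = (if spine \<in> G then 1 else p (n - card (touched G)))" for G
  define M where "M = contraction (thag n) F"
  define U where "U = {2..<n + 2} - touched F"
  define u where "u = n - card (touched F)"
  define c where "c = card (touched F)"
  have tF: "touched F \<subseteq> {2..<n + 2}" and FK: "F \<subseteq> K11 n"
    using F touched_K11[of F n] by (auto simp: flats_thag)
  have fU: "finite U" by (simp add: U_def)
  have cU: "card U = u"
    using tF finite_subset[OF tF] by (simp add: U_def u_def card_Diff_subset)
  have cn: "c + u = n"
    using card_mono[OF _ tF] by (simp add: u_def c_def)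
  have M: "is_matroid M" "loopless M"
    using thag.matroid_contraction[of F n] FK thag.loopless_contraction[OF F] by (simp_all add: M_def)
  have rkM: "rk M = n + 1 - (c + of_bool (spine \<in> F))"
    using thag.rk_contraction[of F n] FK by (simp add: M_def rk_thag rank_flat_thag[OF F] c_def)
  \<comment> \<open>\<open>S\<close> is the Z-polynomial with all conjectured values inserted. By
    induction it differs from the true one only in the summand G = F; both are palindromic, so
    \<open>rv_eqI\<close> identifies that summand.\<close>
  define S where "S = (\<Sum>G | G \<in> flats (thag n) \<and> F \<subseteq> G.
      monom 1 (rank_of (thag n) G - rank_of (thag n) F) * W G)"
  define R where "R = (\<Sum>G | G \<in> flats (thag n) \<and> F \<subset> G.
      monom 1 (rank_of (thag n) G - rank_of (thag n) F) * W G)"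
  have fin: "finite {G. G \<in> flats (thag n) \<and> F \<subset> G}" by simp
  have set_eq: "{G. G \<in> flats (thag n) \<and> F \<subseteq> G} = insert F {G. G \<in> flats (thag n) \<and> F \<subset> G}"
    using F by auto
  have S_eq: "S = W F + R"
    unfolding S_def R_def set_eq by (simp add: monom_0 one_pCons[symmetric])
  have IH: "map_poly of_int (kl (contraction (thag n) G)) = W G"
    if "G \<in> flats (thag n)" "F \<subset> G" for G
  proof -
    have "K11 n - G \<subset> K11 n - F"
      using that thag.flat_subset[of G n] by auto
    then have "card (K11 n - G) < card (K11 n - F)"
      using finite_K11 by (intro psubset_card_mono) auto
    then show ?thesis
      using less.hyps that by (simp add: W_def)
  qed
  have R_eq: "R = (\<Sum>G | G \<in> flats (thag n) \<and> F \<subset> G.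
      monom 1 (rank_of (thag n) G - rank_of (thag n) F) * map_poly of_int (kl (contraction (thag n) G)))"
    unfolding R_def using IH by (intro sum.cong refl) simp
  have Z_eq: "map_poly of_int (Z_poly M) = map_poly of_int (kl M) + R"
    unfolding M_def thag.Z_poly_contraction[OF F] map_poly_of_int_sum map_poly_of_int_monom_mult
      set_eq R_eq
    by (simp add: monom_0 one_pCons[symmetric])
  have spine_sum: "(\<Sum>G | G \<in> flats (thag n) \<and> F \<subseteq> G \<and> spine \<in> G.
      monom 1 (rank_of (thag n) G - rank_of (thag n) F) * W G) =
      monom 1 (of_bool (spine \<notin> F)) * binomial_poly u"
  proof -
    have "(\<Sum>G | G \<in> flats (thag n) \<and> F \<subseteq> G \<and> spine \<in> G.
          monom 1 (rank_of (thag n) G - rank_of (thag n) F) * W G) =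
        (\<Sum>G | G \<in> flats (thag n) \<and> F \<subseteq> G \<and> spine \<in> G.
          monom 1 (card (touched G) + 1 - (c + of_bool (spine \<in> F))))"
      by (intro sum.cong refl) (simp add: W_def rank_flat_thag F c_def)
    also have "\<dots> = (\<Sum>S\<in>Pow U. monom 1 (of_bool (spine \<notin> F) + card S))"
      unfolding sum_flats_spine[OF F, of "\<lambda>k. monom 1 (k + 1 - (c + of_bool (spine \<in> F)))"] U_def
      by (intro sum.cong refl) (simp add: c_def)
    also have "\<dots> = (\<Sum>k\<le>u. monom 1 (of_bool (spine \<notin> F)) * monom (of_nat (u choose k)) k)"
      unfolding sum_Pow_card[OF fU, of "\<lambda>k. monom 1 (of_bool (spine \<notin> F) + k)"] cU
      by (simp add: of_nat_mult_monom mult_monom)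
    finally show ?thesis
      by (simp add: binomial_poly_def sum_distrib_left)
  qed
  have S_split: "S = (\<Sum>G | G \<in> flats (thag n) \<and> F \<subseteq> G \<and> spine \<in> G.
        monom 1 (rank_of (thag n) G - rank_of (thag n) F) * W G) +
      (\<Sum>G | G \<in> flats (thag n) \<and> F \<subseteq> G \<and> spine \<notin> G.
        monom 1 (rank_of (thag n) G - rank_of (thag n) F) * W G)"
    unfolding S_def by (subst sum.union_disjoint[symmetric]) (auto intro!: sum.cong)
  have S_pal: "rv (rk M) S = S"
  proof (cases "spine \<in> F")
    case True
    then have "{G. G \<in> flats (thag n) \<and> F \<subseteq> G \<and> spine \<notin> G} = {}" by auto
    then have "(\<Sum>G | G \<in> flats (thag n) \<and> F \<subseteq> G \<and> spine \<notin> G.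
        monom 1 (rank_of (thag n) G - rank_of (thag n) F) * W G) = 0"
      by (simp only: sum.empty)
    then have "S = binomial_poly u"
      using S_split spine_sum True by (simp add: monom_0 one_pCons[symmetric])
    moreover have "rk M = u"
      using rkM cn True by simp
    ultimately show ?thesis
      by (simp add: rv_binomial_poly)
  next
    case False
    have "(\<Sum>G | G \<in> flats (thag n) \<and> F \<subseteq> G \<and> spine \<notin> G.
          monom 1 (rank_of (thag n) G - rank_of (thag n) F) * W G) =
        (\<Sum>G | G \<in> flats (thag n) \<and> F \<subseteq> G \<and> spine \<notin> G.
          monom 1 (card (touched G) - c) * p (n - card (touched G)))"
      using False by (intro sum.cong refl) (simp add: W_def rank_flat_thag F c_def)
    also have "\<dots> = (\<Sum>S\<in>Pow U. \<Sum>A\<in>Pow S. monom 1 (card S) * p (u - card S))"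
      unfolding sum_flats_no_spine[OF F False, of "\<lambda>k. monom 1 (k - c) * p (n - k)"] U_def[symmetric]
      by (intro sum.cong refl) (simp add: c_def u_def)
    also have "\<dots> = (\<Sum>S\<in>Pow U. of_nat (2 ^ card S) * (monom 1 (card S) * p (u - card S)))"
    proof (intro sum.cong refl)
      fix S assume "S \<in> Pow U"
      then have "finite S" using fU finite_subset by blast
      then show "(\<Sum>A\<in>Pow S. monom 1 (card S) * p (u - card S)) =
          of_nat (2 ^ card S) * (monom 1 (card S) * p (u - card S))"
        by (simp add: card_Pow del: of_nat_power)
    qed
    also have "\<dots> = (\<Sum>k\<le>u. monom (of_nat (u choose k) * 2 ^ k) k * p (u - k))"
      unfolding sum_Pow_card[OF fU, of "\<lambda>k. of_nat (2 ^ k) * (monom 1 k * p (u - k))"] cU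
      by (simp add: of_nat_mult_monom mult.assoc[symmetric] of_nat_mult[symmetric]
          del: of_nat_mult of_nat_power) (simp add: mult.commute)
    finally have "S = thag_Z p u"
      using S_split spine_sum False by (simp add: thag_Z_def)
    moreover have "rk M = u + 1"
      using rkM cn False by simp
    ultimately show ?thesis
      by (simp only: pal)
  qed
  show ?case
  proof (cases "rk M = 0")
    case True
    then have "spine \<in> F" using rkM cn by (cases "spine \<in> F") auto
    then show ?thesis using kl_rk_0[OF True] by (simp add: M_def)
  next
    case False
    have "rv (rk M) (map_poly of_int (kl M) + R) = map_poly of_int (kl M) + R"
      using kl_degree_Z_poly[OF M] by (simp flip: Z_eq map_poly_of_int_rv)
    then have "rv (rk M) (map_poly of_int (kl M)) - map_poly of_int (kl M) = rv (rk M) (W F) - W F"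
      using S_pal unfolding S_eq rv_add by (simp add: algebra_simps)
    moreover have "2 * degree (map_poly of_int (kl M) :: real poly) < rk M"
      using kl_degree_Z_poly[OF M] False by (simp add: degree_map_poly)
    moreover have "2 * degree (W F) < rk M"
      using deg[of u] rkM cn False by (auto simp: W_def u_def)
    ultimately have "map_poly of_int (kl M) = W F"
      by (rule rv_eqI)
    then show ?thesis by (simp add: M_def W_def)
  qed
qed

corollary KL_K11_eq:
  fixes p :: "nat \<Rightarrow> real poly"
  assumes "\<And>u. 2 * degree (p u) \<le> u" and "\<And>u. rv (u + 1) (thag_Z p u) = thag_Z p u"
  shows "map_poly of_int (KL_K11 n) = p n"
  using kl_thag_contraction[OF assms thag.empty_flat[OF loopless_thag], of n]
    KL_poly_eq_kl[OF matroid_thag loopless_thag, of n]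
  by (simp add: KL_K11_def thag.contraction_empty touched_def)

section \<open>An explicit formula\<close>

lemma degree_poly_shift_diff:
  fixes q :: "real poly"
  assumes "degree q \<noteq> 0"
  shows "degree (pcompose q [:1, 1:] - q) < degree q"
proof -
  have "degree (pcompose q [:1, 1:]) = degree q"
    by (simp add: degree_pcompose)
  moreover have "coeff (pcompose q [:1, 1:]) (degree q) = coeff q (degree q)"
    using lead_coeff_comp[of "[:1, 1:]" q] by (simp add: calculation)
  ultimately have "coeff (pcompose q [:1, 1:] - q) i = 0" if "i \<ge> degree q" for i
    using that by (cases "i = degree q") (auto simp: coeff_eq_0)
  then show ?thesis
    using assms by (intro degree_lessI) auto
qed

text \<open>This is an n-th finite difference. Pascal's rule reduces it to the next lower difference
  of q(x + 1) - q(x), whose degree is smaller, or which is zero if q is constant.\<close>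

lemma alternating_binomial_sum_poly:
  fixes q :: "real poly"
  assumes "degree q < n"
  shows "(\<Sum>i\<le>n. (-1) ^ i * real (n choose i) * poly q (real i)) = 0"
  using assms
proof (induction n arbitrary: q)
  case (Suc n)
  define f where "f i = poly q (real i)" for i
  have "(\<Sum>i\<le>Suc n. (-1) ^ i * real (Suc n choose i) * f i) =
      f 0 + (\<Sum>i\<le>n. (-1) ^ Suc i * real (Suc n choose Suc i) * f (Suc i))"
    by (subst sum.atMost_Suc_shift) simp
  also have "\<dots> = (f 0 + (\<Sum>i\<le>n. (-1) ^ Suc i * real (n choose Suc i) * f (Suc i))) -
      (\<Sum>i\<le>n. (-1) ^ i * real (n choose i) * f (Suc i))"
    by (simp add: algebra_simps sum.distrib sum_negf sum_subtractf)
  also have "f 0 + (\<Sum>i\<le>n. (-1) ^ Suc i * real (n choose Suc i) * f (Suc i)) =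
      (\<Sum>i\<le>Suc n. (-1) ^ i * real (n choose i) * f i)"
    by (subst sum.atMost_Suc_shift) simp
  also have "\<dots> = (\<Sum>i\<le>n. (-1) ^ i * real (n choose i) * f i)"
    by simp
  finally have step: "(\<Sum>i\<le>Suc n. (-1) ^ i * real (Suc n choose i) * f i) =
      - (\<Sum>i\<le>n. (-1) ^ i * real (n choose i) * (f (Suc i) - f i))"
    by (simp add: sum_negf[symmetric] sum_subtractf[symmetric] algebra_simps)
  have diff: "f (Suc i) - f i = poly (pcompose q [:1, 1:] - q) (real i)" for i
    by (simp add: f_def poly_pcompose add.commute)
  show ?case
  proof (cases "degree q = 0")
    case True
    then have "f (Suc i) - f i = 0" for i
      by (auto simp: f_def elim!: degree_eq_zeroE)
    then show ?thesis
      using step by (simp add: f_def)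
  next
    case False
    then have "degree (pcompose q [:1, 1:] - q) < n"
      using degree_poly_shift_diff[of q] Suc.prems by linarith
    then have "(\<Sum>i\<le>n. (-1) ^ i * real (n choose i) * (f (Suc i) - f i)) = 0"
      unfolding diff by (rule Suc.IH)
    then show ?thesis
      unfolding f_def[symmetric] step by simp
  qed
qed simp

definition thag_coeff :: "nat \<Rightarrow> nat \<Rightarrow> real" where
  "thag_coeff n i = real ((2 * n - 2 * i choose n) * (n + 1 choose i)) / real (n + 1)"

text \<open>Summing up to n and not only to n div 2 lets finite differences apply directly; the
  coefficients with n < 2 i vanish by themselves.\<close>

definition thag_poly :: "nat \<Rightarrow> real poly" where
  "thag_poly n = (\<Sum>i\<le>n. smult (thag_coeff n i) ([:-1, 1:] ^ i))"

lemma poly_thag_poly: "poly (thag_poly n) x = (\<Sum>i\<le>n. thag_coeff n i * (x - 1) ^ i)"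
  by (simp add: thag_poly_def poly_sum)

lemma thag_coeff_eq_0: "n < 2 * i \<Longrightarrow> i \<le> n \<Longrightarrow> thag_coeff n i = 0"
  by (simp add: thag_coeff_def)

lemma degree_thag_poly: "2 * degree (thag_poly n) \<le> n"
proof -
  have "degree (smult (thag_coeff n i) ([:-1, 1:] ^ i)) \<le> n div 2" if "i \<le> n" for i
  proof (cases "n < 2 * i")
    case False
    have "degree (smult (thag_coeff n i) ([:-1, 1:] ^ i)) \<le> degree ([:-1, 1::real:] ^ i)"
      by (rule degree_smult_le)
    also have "\<dots> = i" by (simp add: degree_power_eq)
    finally show ?thesis using False by linarith
  qed (use that in \<open>simp add: thag_coeff_eq_0\<close>)
  then have "degree (thag_poly n) \<le> n div 2"
    unfolding thag_poly_def by (intro degree_sum_le) auto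
  then show ?thesis by linarith
qed

text \<open>The binomial coefficient (2 n - 2 x choose n) as a polynomial in x. It interpolates the
  natural numbers in \<open>thag_coeff\<close> for i \<le> n and extends them to i = n + 1, where
  the upper entry is -2.\<close>

definition choose_poly :: "nat \<Rightarrow> real poly" where
  "choose_poly n = smult (1 / fact n) (\<Prod>k\<in>{0..<n}. [:2 * real n - real k, -2:])"

lemma poly_choose_poly: "poly (choose_poly n) x = (2 * real n - 2 * x) gchoose n"
  by (simp add: choose_poly_def poly_prod gbinomial_prod_rev algebra_simps)

lemma poly_choose_poly_nat:
  assumes "i \<le> n"
  shows "poly (choose_poly n) (real i) = real (2 * n - 2 * i choose n)"
proof -
  have "2 * real n - 2 * real i = real (2 * n - 2 * i)"
    using assms by (simp add: of_nat_diff)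
  then show ?thesis
    by (simp only: poly_choose_poly binomial_gbinomial)
qed

lemma poly_choose_poly_Suc: "poly (choose_poly n) (real (n + 1)) = (-1) ^ n * real (n + 1)"
proof -
  have "((-2::real) gchoose n) = (-1) ^ n * (real (n + 1) gchoose n)"
    using gbinomial_minus[of "2::real" n] by (simp add: algebra_simps)
  moreover have "2 * real n - 2 * real (n + 1) = -2"
    by simp
  moreover have "real (n + 1) gchoose n = real (n + 1)"
    by (subst binomial_gbinomial[symmetric]) simp
  ultimately show ?thesis
    by (simp only: poly_choose_poly)
qed

lemma degree_choose_poly: "degree (choose_poly n) \<le> n"
proof -
  have "degree (\<Prod>k\<in>{0..<n}. [:2 * real n - real k, -2:]) \<le> n"
    using degree_prod_sum_le[of "{0..<n}" "\<lambda>k. [:2 * real n - real k, -2:]"] by simp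
  then show ?thesis
    unfolding choose_poly_def by (rule order_trans[OF degree_smult_le])
qed

text \<open>The value of \<open>thag_poly n\<close> at 0. The difference of order n + 1 of
  \<open>choose_poly n\<close> is zero, and its last node supplies the 1.\<close>

lemma sum_thag_coeff: "(\<Sum>i\<le>n. (-1) ^ i * thag_coeff n i) = 1"
proof -
  have "(\<Sum>i\<le>n. (-1) ^ i * thag_coeff n i) =
      (\<Sum>i\<le>n. (-1) ^ i * real (n + 1 choose i) * poly (choose_poly n) (real i)) / real (n + 1)"
    unfolding sum_divide_distrib
    by (intro sum.cong refl) (simp add: thag_coeff_def poly_choose_poly_nat)
  moreover have "(\<Sum>i\<le>n + 1. (-1) ^ i * real (n + 1 choose i) * poly (choose_poly n) (real i)) = 0"
    using degree_choose_poly[of n] by (intro alternating_binomial_sum_poly) simp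
  then have "(\<Sum>i\<le>n. (-1) ^ i * real (n + 1 choose i) * poly (choose_poly n) (real i)) =
      (-1) ^ n * poly (choose_poly n) (real (n + 1))"
    by simp
  then have "(\<Sum>i\<le>n. (-1) ^ i * real (n + 1 choose i) * poly (choose_poly n) (real i)) = real (n + 1)"
    unfolding poly_choose_poly_Suc left_minus_one_mult_self .
  ultimately show ?thesis by simp
qed

text \<open>The denominators come from integrating x^(n-2i) x^(n-2j) over [0, 1], the right side is
  minus the integral of x^(2j). Division by the denominator cancels a linear factor of
  \<open>choose_poly n\<close>, and the difference of order n + 1 of the quotient \<open>q\<close>
  is again zero.\<close>

lemma thag_coeff_moment:
  assumes "1 \<le> j" and "2 * j \<le> n"
  shows "(\<Sum>i\<le>n. (-1) ^ i * thag_coeff n i / (2 * real n - 2 * real i - 2 * real j + 1)) =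
    - 1 / (2 * real j + 1)"
proof -
  \<comment> \<open>The factor with k = 2 j - 1 is 2 n - 2 x - 2 j + 1; the bounds on
    \<open>j\<close> say that this k occurs in the product.\<close>
  define q where "q = smult (1 / fact n) (\<Prod>k\<in>{0..<n} - {2 * j - 1}. [:2 * real n - real k, -2:])"
  have mem: "2 * j - 1 \<in> {0..<n}" using assms by auto
  have split: "poly (choose_poly n) x = (2 * real n - 2 * x - 2 * real j + 1) * poly q x" for x
  proof -
    have "poly [:2 * real n - real (2 * j - 1), -2:] x = 2 * real n - 2 * x - 2 * real j + 1"
      using assms by (simp add: of_nat_diff)
    then show ?thesis
      unfolding choose_poly_def q_def poly_smult poly_prod
      by (subst prod.remove[OF _ mem]) simp_all
  qed
  have odd: "2 * real n - 2 * real i - 2 * real j + 1 \<noteq> 0" for i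
  proof
    assume "2 * real n - 2 * real i - 2 * real j + 1 = 0"
    then have "real (2 * n + 1) = real (2 * i + 2 * j)" by simp
    then have "2 * n + 1 = 2 * i + 2 * j" unfolding of_nat_eq_iff .
    then show False by presburger
  qed
  have "degree (\<Prod>k\<in>{0..<n} - {2 * j - 1}. [:2 * real n - real k, -2:]) \<le> n"
    using degree_prod_sum_le[of "{0..<n} - {2 * j - 1}" "\<lambda>k. [:2 * real n - real k, -2:]"] mem
    by simp
  then have "degree q < n + 1"
    unfolding q_def using order_trans[OF degree_smult_le] by (simp add: less_Suc_eq_le)
  then have sum0: "(\<Sum>i\<le>n + 1. (-1) ^ i * real (n + 1 choose i) * poly q (real i)) = 0"
    by (rule alternating_binomial_sum_poly)
  have "(\<Sum>i\<le>n. (-1) ^ i * thag_coeff n i / (2 * real n - 2 * real i - 2 * real j + 1)) =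
      (\<Sum>i\<le>n. (-1) ^ i * real (n + 1 choose i) * poly q (real i)) / real (n + 1)"
    unfolding sum_divide_distrib
  proof (intro sum.cong refl)
    fix i assume "i \<in> {..n}"
    then have "thag_coeff n i =
        (2 * real n - 2 * real i - 2 * real j + 1) * (real (n + 1 choose i) * poly q (real i) / real (n + 1))"
      using poly_choose_poly_nat[of i n] split[of "real i"] by (simp add: thag_coeff_def)
    then show "(-1) ^ i * thag_coeff n i / (2 * real n - 2 * real i - 2 * real j + 1) =
        (-1) ^ i * real (n + 1 choose i) * poly q (real i) / real (n + 1)"
      using odd[of i] by simp
  qed
  also have "(\<Sum>i\<le>n. (-1) ^ i * real (n + 1 choose i) * poly q (real i)) =
      (-1) ^ n * poly q (real (n + 1))"
    using sum0 by simp
  also have "(-1) ^ n * poly q (real (n + 1)) = - real (n + 1) / (2 * real j + 1)"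
  proof -
    have "(-1) ^ n * real (n + 1) = - (2 * real j + 1) * poly q (real (n + 1))"
      using split[of "real (n + 1)"] poly_choose_poly_Suc[of n] by (simp add: algebra_simps)
    then have "(-1) ^ n * ((-1) ^ n * real (n + 1)) =
        - (2 * real j + 1) * ((-1) ^ n * poly q (real (n + 1)))"
      by (simp only: mult_ac)
    moreover have "(-1) ^ n * ((-1) ^ n * real (n + 1)) = real (n + 1)"
      by (simp add: mult.assoc[symmetric] power_add[symmetric] mult_2[symmetric] del: of_nat_add)
    moreover have "2 * real j + 1 \<noteq> 0" by linarith
    ultimately show ?thesis by (simp add: field_simps)
  qed
  finally show ?thesis by (simp del: of_nat_add of_nat_Suc)
qed

text \<open>With y = 1 + X and m = n - l, both sides are the coefficient of X^n in y^(2m) (y^2 -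
  1)^l: expand the power by the binomial theorem, or use y^2 - 1 = X (X + 2).\<close>

lemma binomial_sum_identity:
  assumes "l \<le> n"
  shows "(\<Sum>i\<le>l. (-1) ^ i * real (l choose i) * real (2 * n - 2 * i choose n)) =
    (\<Sum>i\<le>l. 2 ^ (l - i) * real (l choose i) * real (2 * (n - l) choose (n - l + i)))"
proof -
  define y where "y = ([:1, 1:] :: real poly)"
  define m where "m = n - l"
  have pw: "coeff (y ^ N) k = real (N choose k)" for N k
    by (cases "k \<le> N") (auto simp: y_def coeff_linear_poly_power binomial_eq_0 coeff_eq_0 degree_power_eq)
  have sq: "y ^ 2 - 1 = monom 1 1 * [:2, 1:]"
    by (simp add: y_def power2_eq_square monom_altdef one_pCons)
  have "(y ^ 2 - 1) ^ l = (\<Sum>i\<le>l. of_nat (l choose i) * (-1) ^ i * (y ^ 2) ^ (l - i))"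
    using binomial_ring[of "-1" "y ^ 2" l] by (simp add: add.commute)
  then have "y ^ (2 * m) * (y ^ 2 - 1) ^ l =
      (\<Sum>i\<le>l. of_nat (l choose i) * (-1) ^ i * y ^ (2 * m + 2 * (l - i)))"
    by (simp add: sum_distrib_left power_mult[symmetric] power_add mult_ac)
  also have "\<dots> = (\<Sum>i\<le>l. smult ((-1) ^ i * real (l choose i)) (y ^ (2 * n - 2 * i)))"
  proof (intro sum.cong refl)
    fix i assume "i \<in> {..l}"
    then have "2 * m + 2 * (l - i) = 2 * n - 2 * i"
      using assms by (auto simp: m_def)
    moreover have "of_nat (l choose i) * (-1) ^ i = ([:(-1) ^ i * real (l choose i):] :: real poly)"
      by (cases "even i") (simp_all add: of_nat_poly)
    ultimately show "of_nat (l choose i) * (-1) ^ i * y ^ (2 * m + 2 * (l - i)) =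
        smult ((-1) ^ i * real (l choose i)) (y ^ (2 * n - 2 * i))"
      by simp
  qed
  finally have "coeff (y ^ (2 * m) * (y ^ 2 - 1) ^ l) n =
      (\<Sum>i\<le>l. (-1) ^ i * real (l choose i) * real (2 * n - 2 * i choose n))"
    by (simp add: coeff_sum pw)
  moreover have "coeff (y ^ (2 * m) * (y ^ 2 - 1) ^ l) n = coeff (y ^ (2 * m) * [:2, 1:] ^ l) m"
  proof -
    have eq: "y ^ (2 * m) * (y ^ 2 - 1) ^ l = monom 1 l * (y ^ (2 * m) * [:2, 1:] ^ l)"
      unfolding sq power_mult_distrib monom_power by (simp only: mult_ac mult_1 power_one)
    show ?thesis unfolding eq coeff_monom_mult using assms by (simp add: m_def)
  qed
  moreover have "coeff (y ^ (2 * m) * [:2, 1:] ^ l) m =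
      (\<Sum>i\<le>l. 2 ^ (l - i) * real (l choose i) * real (2 * m choose (m + i)))"
  proof -
    have c2: "coeff ([:2, 1:] ^ l) i = (if i \<le> l then real (l choose i) * 2 ^ (l - i) else 0)" for i
      by (auto simp: coeff_linear_poly_power coeff_eq_0 degree_power_eq)
    have "coeff ([:2, 1:] ^ l * y ^ (2 * m)) m =
        (\<Sum>i\<le>m. (if i \<le> l then real (l choose i) * 2 ^ (l - i) else 0) * real (2 * m choose (m - i)))"
      by (simp add: coeff_mult pw c2)
    also have "\<dots> = (\<Sum>i\<in>{..m} \<inter> {..l}. 2 ^ (l - i) * real (l choose i) * real (2 * m choose (m - i)))"
      by (rule sum.mono_neutral_cong_right) auto
    also have "\<dots> = (\<Sum>i\<in>{..m} \<inter> {..l}. 2 ^ (l - i) * real (l choose i) * real (2 * m choose (m + i)))"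
    proof (intro sum.cong refl)
      fix i assume "i \<in> {..m} \<inter> {..l}"
      then have "2 * m choose (m - i) = 2 * m choose (m + i)"
        using binomial_symmetric[of "m - i" "2 * m"] by (auto intro!: arg_cong[of _ _ "\<lambda>k. _ choose k"])
      then show "2 ^ (l - i) * real (l choose i) * real (2 * m choose (m - i)) =
          2 ^ (l - i) * real (l choose i) * real (2 * m choose (m + i))" by simp
    qed
    also have "\<dots> = (\<Sum>i\<le>l. 2 ^ (l - i) * real (l choose i) * real (2 * m choose (m + i)))"
      by (rule sum.mono_neutral_left) auto
    finally show ?thesis by (simp add: mult.commute)
  qed
  ultimately show ?thesis by (simp add: m_def)
qed

text \<open>Here and in \<open>choose_mult_thag_coeff\<close> the same factor, depending only on l,
  is pulled out; what remains are the summands of the two sides of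
  \<open>binomial_sum_identity\<close>.\<close>

lemma thag_coeff_mult_choose:
  assumes "i \<le> l" and "l \<le> n + 1" and "i \<le> n"
  shows "thag_coeff n i * real (n + 1 - i choose (l - i)) =
    real (n + 1 choose l) / real (n + 1) * (real (l choose i) * real (2 * n - 2 * i choose n))"
proof -
  have "real (n + 1 choose l) * real (l choose i) = real (n + 1 choose i) * real (n + 1 - i choose (l - i))"
    using choose_mult[OF assms(1,2)] by (simp only: of_nat_mult[symmetric])
  then show ?thesis
    by (simp add: thag_coeff_def mult_ac)
qed

lemma choose_mult_thag_coeff:
  assumes "i \<le> l" and "l \<le> n"
  shows "real (n choose (l - i)) * thag_coeff (n - (l - i)) i =
    real (n + 1 choose l) / real (n + 1) * (real (l choose i) * real (2 * (n - l) choose (n - l + i)))"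
proof -
  define k where "k = l - i"
  have l: "l = k + i" and k: "k \<le> l" "k \<le> n" using assms by (auto simp: k_def)
  have "(n + 1 - k) * (n + 1 choose k) = (n + 1) * (n choose k)"
    using binomial_absorb_comp[of "n + 1" k] by simp
  then have "real (n + 1 - k) * real (n + 1 choose k) = real (n + 1) * real (n choose k)"
    by (simp only: of_nat_mult[symmetric])
  then have *: "real (n choose k) / real (n + 1 - k) = real (n + 1 choose k) / real (n + 1)"
    using k by (simp add: field_simps)
  have **: "real (n + 1 choose k) * real (n + 1 - k choose i) = real (n + 1 choose l) * real (l choose i)"
    using choose_mult[of k l "n + 1"] assms k binomial_symmetric[of i l]
    by (simp only: of_nat_mult[symmetric]) (simp add: l)
  have "2 * (n - k) - 2 * i = 2 * (n - l)" "n - k = n - l + i" "n - k + 1 = n + 1 - k"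
    using assms by (auto simp: l)
  then have "real (n choose k) * thag_coeff (n - k) i =
      real (n choose k) / real (n + 1 - k) * real (n + 1 - k choose i) * real (2 * (n - l) choose (n - l + i))"
    by (simp add: thag_coeff_def)
  then show ?thesis
    unfolding * k_def[symmetric] using ** by (simp add: mult_ac)
qed

text \<open>This is condition (3) for K_{1,1,n}. A flat of k single spokes has characteristic
  polynomial (x - 1)^k; a full fan over k vertices has (x - 1) (x - 2)^k, and these sum to (x -
  1)^(n+1). The proof compares coefficients of powers of s = x - 1.\<close>

lemma thag_poly_recursion:
  fixes x :: real
  assumes "x \<noteq> 0"
  shows "x ^ (n + 1) * poly (thag_poly n) (1 / x) =
    (x - 1) ^ (n + 1) + (\<Sum>k\<le>n. real (n choose k) * (2 * (x - 1)) ^ k * poly (thag_poly (n - k)) x)"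
proof -
  define s where "s = x - 1"
  define D where "D l = real (n + 1 choose l) / real (n + 1)" for l
  \<comment> \<open>\<open>a i l\<close> and \<open>b i l\<close> are the contributions of index i
    to the coefficient of s^l on the two sides; in \<open>b\<close> the summation index k of the
    right side is l - i.\<close>
  define a where "a i l = (-1) ^ i * thag_coeff n i * real (n + 1 - i choose (l - i))" for i l
  define b where "b i l = real (n choose (l - i)) * 2 ^ (l - i) * thag_coeff (n - (l - i)) i" for i l
  have "x ^ (n + 1) * poly (thag_poly n) (1 / x) =
      (\<Sum>i\<le>n. (-1) ^ i * thag_coeff n i * s ^ i * (s + 1) ^ (n + 1 - i))"
    unfolding poly_thag_poly sum_distrib_left
  proof (intro sum.cong refl)
    fix i assume "i \<in> {..n}"
    then have "x ^ (n + 1) = x ^ i * x ^ (n + 1 - i)"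
      by (simp add: power_add[symmetric])
    moreover have "x * (1 / x - 1) = (-1) * s"
      using assms by (simp add: s_def field_simps)
    then have "x ^ i * (1 / x - 1) ^ i = (-1) ^ i * s ^ i"
      by (simp only: power_mult_distrib[symmetric])
    moreover have "s + 1 = x"
      by (simp add: s_def)
    ultimately show "x ^ (n + 1) * (thag_coeff n i * (1 / x - 1) ^ i) =
        (-1) ^ i * thag_coeff n i * s ^ i * (s + 1) ^ (n + 1 - i)"
      by (simp only: mult.commute mult.left_commute) (metis mult.commute mult.left_commute)
  qed
  also have "\<dots> = (\<Sum>i\<le>n. \<Sum>l\<in>{i..n + 1}. a i l * s ^ l)"
  proof (intro sum.cong refl)
    fix i assume i: "i \<in> {..n}"
    have "s ^ i * (s + 1) ^ (n + 1 - i) = (\<Sum>j\<le>n + 1 - i. real (n + 1 - i choose j) * s ^ (i + j))"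
      by (simp add: binomial_ring sum_distrib_left power_add mult_ac)
    also have "\<dots> = (\<Sum>l\<in>{i..n + 1}. real (n + 1 - i choose (l - i)) * s ^ l)"
      using i by (intro sum.reindex_bij_witness[of _ "\<lambda>l. l - i" "\<lambda>j. i + j"]) auto
    finally show "(-1) ^ i * thag_coeff n i * s ^ i * (s + 1) ^ (n + 1 - i) = (\<Sum>l\<in>{i..n + 1}. a i l * s ^ l)"
      by (simp only: a_def sum_distrib_left mult.assoc)
  qed
  \<comment> \<open>l runs up to n + 1 while i stops at n. The coefficients with l \<le> n are
    settled by \<open>binomial_sum_identity\<close>, the top one by
    \<open>sum_thag_coeff\<close>.\<close>
  also have "\<dots> = (\<Sum>l\<le>n + 1. \<Sum>i\<le>min l n. a i l * s ^ l)"
    unfolding sum.Sigma[OF finite_atMost ballI[OF finite_atLeastAtMost]]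
      sum.Sigma[OF finite_atMost ballI[OF finite_atMost]]
    by (rule sum.reindex_bij_witness[of _ "\<lambda>(l, i). (i, l)" "\<lambda>(i, l). (l, i)"]) auto
  also have "\<dots> = s ^ (n + 1) + (\<Sum>l\<le>n. \<Sum>i\<le>l. b i l * s ^ l)"
  proof -
    have ab: "(\<Sum>i\<le>min l n. a i l) = (\<Sum>i\<le>l. b i l)" if l: "l \<le> n" for l
    proof -
      have "(\<Sum>i\<le>l. a i l) = D l * (\<Sum>i\<le>l. (-1) ^ i * real (l choose i) * real (2 * n - 2 * i choose n))"
        unfolding sum_distrib_left a_def
      proof (intro sum.cong refl)
        fix i assume "i \<in> {..l}"
        then have *: "thag_coeff n i * real (n + 1 - i choose (l - i)) =
            D l * (real (l choose i) * real (2 * n - 2 * i choose n))"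
          unfolding D_def using l by (intro thag_coeff_mult_choose) auto
        show "(-1) ^ i * thag_coeff n i * real (n + 1 - i choose (l - i)) =
            D l * ((-1) ^ i * real (l choose i) * real (2 * n - 2 * i choose n))"
          unfolding mult.assoc * by (simp only: mult_ac)
      qed
      also have "\<dots> = (\<Sum>i\<le>l. b i l)"
        unfolding binomial_sum_identity[OF l] sum_distrib_left b_def
      proof (intro sum.cong refl)
        fix i assume "i \<in> {..l}"
        then have "real (n choose (l - i)) * thag_coeff (n - (l - i)) i =
            D l * (real (l choose i) * real (2 * (n - l) choose (n - l + i)))"
          unfolding D_def using l by (intro choose_mult_thag_coeff) auto
        then have "2 ^ (l - i) * (real (n choose (l - i)) * thag_coeff (n - (l - i)) i) =
            2 ^ (l - i) * (D l * (real (l choose i) * real (2 * (n - l) choose (n - l + i))))"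
          by (simp only:)
        then show "D l * (2 ^ (l - i) * real (l choose i) * real (2 * (n - l) choose (n - l + i))) =
            real (n choose (l - i)) * 2 ^ (l - i) * thag_coeff (n - (l - i)) i"
          by (simp only: mult_ac)
      qed
      finally show ?thesis using l by (simp add: min_absorb1)
    qed
    have "(\<Sum>i\<le>n. a i (n + 1)) = 1"
      using sum_thag_coeff[of n] by (simp add: a_def)
    moreover have "(\<Sum>l\<le>n. \<Sum>i\<le>min l n. a i l * s ^ l) = (\<Sum>l\<le>n. \<Sum>i\<le>l. b i l * s ^ l)"
      by (rule sum.cong[OF refl]) (simp only: atMost_iff sum_distrib_right[symmetric] ab)
    ultimately show ?thesis
      by (simp add: sum_distrib_right[symmetric])
  qed
  also have "(\<Sum>l\<le>n. \<Sum>i\<le>l. b i l * s ^ l) =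
      (\<Sum>k\<le>n. \<Sum>i\<le>n - k. real (n choose k) * (2 * s) ^ k * (thag_coeff (n - k) i * s ^ i))"
    unfolding sum.Sigma[OF finite_atMost ballI[OF finite_atMost]]
    by (rule sum.reindex_bij_witness[of _ "\<lambda>(k, i). (k + i, i)" "\<lambda>(l, i). (l - i, i)"])
      (auto simp: b_def power_mult_distrib power_add[symmetric] mult_ac)
  also have "\<dots> = (\<Sum>k\<le>n. real (n choose k) * (2 * s) ^ k * poly (thag_poly (n - k)) x)"
    by (simp add: poly_thag_poly sum_distrib_left s_def)
  finally show ?thesis by (simp add: s_def)
qed

section \<open>Generating functions: from the recursion to the symmetry of Z\<close>

lemma fps_exp_mult_egf:
  "fps_nth (fps_exp a * Abs_fps (\<lambda>n. f n / fact n)) n * fact n =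
    (\<Sum>k\<le>n. real (n choose k) * a ^ k * f (n - k))" for a :: real
  unfolding fps_mult_nth sum_distrib_right atLeast0AtMost
  by (intro sum.cong refl) (simp add: binomial_fact)

lemma poly_thag_Z:
  fixes p :: "nat \<Rightarrow> real poly"
  shows "poly (thag_Z p n) x = (\<Sum>k\<le>n. real (n choose k) * (2 * x) ^ k * poly (p (n - k)) x) + x * (1 + x) ^ n"
proof -
  have "poly (binomial_poly n) x = (x + 1) ^ n"
    by (simp add: binomial_poly_def poly_sum poly_monom binomial_ring)
  then show ?thesis
    by (simp add: thag_Z_def poly_sum poly_monom power_mult_distrib mult_ac add.commute)
qed

text \<open>In terms of exponential generating functions, the recursion for \<^const>\<open>thag_poly\<close> reads
  \<open>N = s exp(s u) + exp(2 s u) F\<close> with \<open>s = x - 1\<close>; multiplying by \<open>exp(2 u)\<close> gives the symmetry.\<close>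

lemma poly_thag_Z_symmetric:
  fixes x :: real
  assumes "x \<noteq> 0"
  shows "x ^ (n + 1) * poly (thag_Z thag_poly n) (1 / x) = poly (thag_Z thag_poly n) x"
proof -
  define s where "s = x - 1"
  define f where "f m = poly (thag_poly m) x" for m
  define g where "g m = x ^ (m + 1) * poly (thag_poly m) (1 / x)" for m
  define F where "F = Abs_fps (\<lambda>m. f m / fact m)"
  define N where "N = Abs_fps (\<lambda>m. g m / fact m)"
  have N: "N = fps_const s * fps_exp s + fps_exp (2 * s) * F"
  proof (rule fps_ext)
    fix m
    have "fps_nth N m * fact m = fps_nth (fps_const s * fps_exp s + fps_exp (2 * s) * F) m * fact m"
      unfolding fps_add_nth distrib_right F_def fps_exp_mult_egf
      using thag_poly_recursion[OF assms, of m] by (simp add: N_def g_def f_def s_def)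
    then show "fps_nth N m = fps_nth (fps_const s * fps_exp s + fps_exp (2 * s) * F) m"
      by simp
  qed
  \<comment> \<open>The left side generates x^(n+1) Z(1/x): its last summand is x^(n+1) times (1/x)
    (1 + 1/x)^n. The right side is brought into the form that generates Z(x).\<close>
  have "fps_exp 2 * N + fps_exp (1 + x) =
      fps_const s * (fps_exp 2 * fps_exp s) + (fps_exp 2 * fps_exp (2 * s)) * F + fps_exp (1 + x)"
    unfolding N by (simp add: algebra_simps)
  also have "fps_exp 2 * fps_exp s = fps_exp (1 + x)"
    by (simp add: fps_exp_add_mult[symmetric] s_def)
  also have "fps_exp 2 * fps_exp (2 * s) = fps_exp (2 * x)"
    by (simp add: fps_exp_add_mult[symmetric] s_def)
  also have "fps_const s * fps_exp (1 + x) + fps_exp (2 * x) * F + fps_exp (1 + x) =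
      fps_exp (2 * x) * F + fps_const x * fps_exp (1 + x)"
  proof -
    have "fps_const x = fps_const s + 1"
      by (simp add: s_def fps_const_sub[symmetric] del: fps_const_sub)
    then show ?thesis by (simp add: algebra_simps)
  qed
  finally have "fps_nth (fps_exp 2 * N + fps_exp (1 + x)) n * fact n =
      fps_nth (fps_exp (2 * x) * F + fps_const x * fps_exp (1 + x)) n * fact n"
    by simp
  then have "(\<Sum>k\<le>n. real (n choose k) * 2 ^ k * g (n - k)) + (1 + x) ^ n =
      (\<Sum>k\<le>n. real (n choose k) * (2 * x) ^ k * f (n - k)) + x * (1 + x) ^ n"
    unfolding fps_add_nth distrib_right N_def F_def fps_exp_mult_egf by simp
  also have "\<dots> = poly (thag_Z thag_poly n) x"
    by (simp add: poly_thag_Z f_def)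
  also have "(\<Sum>k\<le>n. real (n choose k) * 2 ^ k * g (n - k)) + (1 + x) ^ n =
      x ^ (n + 1) * poly (thag_Z thag_poly n) (1 / x)"
  proof -
    have "(1 + x) ^ n = x ^ (n + 1) * (1 / x * (1 + 1 / x) ^ n)"
    proof -
      have "1 + x = x * (1 + 1 / x)"
        using assms by (simp add: field_simps)
      then have "(1 + x) ^ n = (x * (1 + 1 / x)) ^ n"
        by (simp only:)
      then show ?thesis
        using assms by (simp add: power_mult_distrib)
    qed
    moreover have "real (n choose k) * 2 ^ k * g (n - k) =
        x ^ (n + 1) * (real (n choose k) * (2 * (1 / x)) ^ k * poly (thag_poly (n - k)) (1 / x))"
      if "k \<le> n" for k
    proof -
      have "x ^ (n + 1) * (2 * (1 / x)) ^ k = 2 ^ k * x ^ (n - k + 1)"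
        using assms that by (simp add: power_mult_distrib power_diff power_one_over field_simps)
      then have "real (n choose k) * (x ^ (n + 1) * (2 * (1 / x)) ^ k) * poly (thag_poly (n - k)) (1 / x) =
          real (n choose k) * 2 ^ k * g (n - k)"
        by (simp only: g_def mult_ac)
      then show ?thesis
        by (simp only: mult_ac)
    qed
    ultimately show ?thesis
      unfolding poly_thag_Z distrib_left sum_distrib_left
      by (intro arg_cong2[where f = "(+)"] sum.cong refl) auto
  qed
  finally show ?thesis .
qed

lemma degree_thag_Z: "degree (thag_Z thag_poly n) \<le> n + 1"
proof -
  have "degree (monom (real (n choose k) * 2 ^ k) k * thag_poly (n - k)) \<le> n + 1" if "k \<le> n" for k
    using degree_mult_le[of "monom (real (n choose k) * 2 ^ k) k" "thag_poly (n - k)"]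
      degree_monom_le[of "real (n choose k) * 2 ^ k" k] degree_thag_poly[of "n - k"] that by linarith
  moreover have "degree (binomial_poly n :: real poly) \<le> n"
    unfolding binomial_poly_def by (intro degree_sum_le) (auto intro: order_trans[OF degree_monom_le])
  then have "degree (monom 1 1 * binomial_poly n :: real poly) \<le> n + 1"
    using degree_mult_le[of "monom (1::real) 1" "binomial_poly n"] degree_monom_le[of "1::real" 1]
    by linarith
  ultimately show ?thesis
    unfolding thag_Z_def by (intro degree_add_le degree_sum_le) auto
qed

lemma rv_thag_Z: "rv (n + 1) (thag_Z thag_poly n) = thag_Z thag_poly n"
proof (rule ccontr)
  define d where "d = rv (n + 1) (thag_Z thag_poly n) - thag_Z thag_poly n"
  assume "rv (n + 1) (thag_Z thag_poly n) \<noteq> thag_Z thag_poly n"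
  then have "finite {x. poly d x = 0}"
    by (intro poly_roots_finite) (simp add: d_def)
  moreover have "- {0} \<subseteq> {x. poly d x = 0}"
    using poly_thag_Z_symmetric[of _ n] poly_rv[OF degree_thag_Z, of _ n] by (auto simp: d_def)
  ultimately have "finite (- {0::real})"
    using finite_subset by blast
  then show False
    using infinite_UNIV_char_0[where 'a = real] by (simp add: finite_compl)
qed

lemma KL_K11_eq_thag_poly: "map_poly of_int (KL_K11 n) = thag_poly n"
  by (rule KL_K11_eq) (use degree_thag_poly rv_thag_Z in auto)

section \<open>Zeros\<close>

text \<open>For nonzero \<open>p\<close>, \<open>Z\<close> consists of the negative roots of odd
  multiplicity. A root between points of opposite sign is split off; if it already occurs in the set
  for the quotient, the pair becomes a square that joins \<open>h\<close>.\<close>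

lemma real_poly_sign_decomposition:
  fixes p :: "real poly"
  shows "\<exists>Z h. finite Z \<and> Z \<subseteq> {..<0} \<and> p = (\<Prod>z\<in>Z. [:-z, 1:]) * h \<and>
    ((\<forall>t\<le>0. 0 \<le> poly h t) \<or> (\<forall>t\<le>0. poly h t \<le> 0))"
proof (induction "degree p" arbitrary: p rule: less_induct)
  case less
  show ?case
  proof (cases "(\<forall>t\<le>0. 0 \<le> poly p t) \<or> (\<forall>t\<le>0. poly p t \<le> 0)")
    case True
    then show ?thesis by (intro exI[of _ "{}"] exI[of _ p]) simp
  next
    case False
    then obtain a b where ab: "a \<le> 0" "b \<le> 0" "poly p a < 0" "0 < poly p b"
      by (auto simp: not_le)
    then have "\<exists>z. min a b < z \<and> z < max a b \<and> poly p z = 0"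
      using poly_IVT[of "min a b" "max a b" p]
      by (cases "a < b") (auto simp: mult_neg_pos mult_pos_neg min_def max_def not_less le_less)
    then obtain z where "z < max a b" "poly p z = 0"
      by blast
    then have z: "z < 0" "poly p z = 0"
      using ab by (auto simp: max_def split: if_splits)
    then obtain q where q: "p = [:-z, 1:] * q"
      by (auto simp: poly_eq_0_iff_dvd elim: dvdE)
    have "p \<noteq> 0" using ab by auto
    then have "degree q < degree p"
      unfolding q by (subst degree_mult_eq) auto
    from less.hyps[OF this] obtain Z h where IH: "finite Z" "Z \<subseteq> {..<0}"
      "q = (\<Prod>z\<in>Z. [:-z, 1:]) * h" "(\<forall>t\<le>0. 0 \<le> poly h t) \<or> (\<forall>t\<le>0. poly h t \<le> 0)"
      by blast
    show ?thesis
    proof (cases "z \<in> Z")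
      case False
      have "p = (\<Prod>z\<in>insert z Z. [:-z, 1:]) * h"
        unfolding q IH(3) prod.insert[OF IH(1) False] mult.assoc ..
      then show ?thesis
        using IH z(1) by (intro exI[of _ "insert z Z"] exI[of _ h]) simp
    next
      case True
      have "p = (\<Prod>z\<in>Z - {z}. [:-z, 1:]) * ([:-z, 1:] ^ 2 * h)"
        unfolding q IH(3) prod.remove[OF IH(1) True] by (simp only: power2_eq_square mult_ac)
      moreover have "poly ([:-z, 1:] ^ 2 * h) t = (t - z) ^ 2 * poly h t" for t
        by simp
      then have "(\<forall>t\<le>0. 0 \<le> poly ([:-z, 1:] ^ 2 * h) t) \<or> (\<forall>t\<le>0. poly ([:-z, 1:] ^ 2 * h) t \<le> 0)"
        using IH(4) by (metis mult_nonneg_nonneg mult_nonneg_nonpos zero_le_power2)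
      ultimately show ?thesis
        using IH by (intro exI[of _ "Z - {z}"] exI[of _ "[:-z, 1:] ^ 2 * h"]) auto
    qed
  qed
qed

section \<open>The orthogonality relations as integrals over [0, 1]\<close>

lemma has_integral_power_unit: "((\<lambda>x::real. x ^ k) has_integral 1 / (real k + 1)) {0..1}"
proof -
  have "((\<lambda>x::real. x ^ k) has_integral (1 ^ Suc k / real (Suc k) - 0 ^ Suc k / real (Suc k))) {0..1}"
  proof (rule fundamental_theorem_of_calculus)
    fix x :: real
    have "((\<lambda>x. x ^ Suc k / real (Suc k)) has_real_derivative real (Suc k) * x ^ k / real (Suc k)) (at x within {0..1})"
      using DERIV_cdivide[OF DERIV_pow[of "Suc k" x "{0..1}"], of "real (Suc k)"] by simp
    then show "((\<lambda>x. x ^ Suc k / real (Suc k)) has_vector_derivative x ^ k) (at x within {0..1})"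
      by (simp add: has_real_derivative_iff_has_vector_derivative[symmetric])
  qed simp
  then show ?thesis by (simp add: add.commute)
qed

text \<open>Replace the N + 1 copies of y^N by the larger 1 + y + ... + y^N and sum the geometric
  series.\<close>

lemma power_mult_one_minus_le:
  fixes y :: real
  assumes "0 \<le> y" and "y \<le> 1"
  shows "real (N + 1) * (y ^ N * (1 - y)) \<le> 1"
proof -
  have "real (N + 1) * y ^ N = (\<Sum>i\<le>N. y ^ N)" by simp
  also have "\<dots> \<le> (\<Sum>i\<le>N. y ^ i)"
    using assms by (intro sum_mono power_decreasing) auto
  finally have "(real (N + 1) * y ^ N) * (1 - y) \<le> (\<Sum>i\<le>N. y ^ i) * (1 - y)"
    using assms by (intro mult_right_mono) auto
  also have "\<dots> = 1 - y ^ Suc N"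
    using sum_gp_basic[of y N] by (simp add: mult.commute)
  also have "\<dots> \<le> 1" using assms by simp
  finally show ?thesis by (simp add: mult.assoc)
qed

text \<open>A form of x^n P_n(1 - 1/x^2) without denominators, hence continuous at 0. Stopping at n
  div 2 keeps the subtraction n - 2 i exact.\<close>

definition thag_profile :: "nat \<Rightarrow> real \<Rightarrow> real" where
  "thag_profile n x = (\<Sum>i\<le>n div 2. (-1) ^ i * thag_coeff n i * x ^ (n - 2 * i))"

lemma thag_profile_eq:
  assumes "x \<noteq> 0"
  shows "thag_profile n x = x ^ n * poly (thag_poly n) (1 - 1 / x ^ 2)"
proof -
  have "poly (thag_poly n) (1 - 1 / x ^ 2) = (\<Sum>i\<le>n div 2. thag_coeff n i * (- 1 / x ^ 2) ^ i)"
    unfolding poly_thag_poly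
  proof (intro sum.mono_neutral_cong_right ballI)
    fix i assume "i \<in> {..n} - {..n div 2}"
    then have "thag_coeff n i = 0" by (intro thag_coeff_eq_0) auto
    then show "thag_coeff n i * (1 - 1 / x ^ 2 - 1) ^ i = 0" by simp
  qed auto
  moreover have term_eq: "x ^ n * (- 1 / x ^ 2) ^ i = (-1) ^ i * x ^ (n - 2 * i)" if "i \<le> n div 2" for i
  proof -
    have "(- 1 / x ^ 2) ^ i = (-1) ^ i * (1 / x ^ 2) ^ i"
      using power_minus[of "1 / x ^ 2" i] by simp
    moreover have "x ^ n * (1 / x ^ 2) ^ i = x ^ (n - 2 * i)"
      using that assms by (simp add: power_divide power_diff power_mult)
    ultimately show ?thesis by (simp only: mult.left_commute[of "x ^ n"])
  qed
  moreover have "(-1) ^ i * thag_coeff n i * x ^ (n - 2 * i) = x ^ n * (thag_coeff n i * (- 1 / x ^ 2) ^ i)"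
    if "i \<le> n div 2" for i
    unfolding mult.left_commute[of "x ^ n"] term_eq[OF that] by (simp only: mult_ac)
  ultimately show ?thesis
    by (simp only: thag_profile_def sum_distrib_left) (rule sum.cong[OF refl], simp only: atMost_iff)
qed

text \<open>The profile, continued to \<open>x > 1\<close> by \<open>x ^ - (n + 2)\<close>, is orthogonal to \<open>x ^ (n - 2 * j)\<close>
  for \<open>1 \<le> j \<le> n div 2\<close>; the tail has been moved to \<open>[0, 1]\<close> by \<open>x \<mapsto> 1 / x\<close>.\<close>

lemma has_integral_thag_profile:
  fixes q :: "real poly"
  assumes q: "degree q < n div 2"
  defines "e \<equiv> n mod 2"
  shows "((\<lambda>x. x ^ e * poly q (x ^ 2) * thag_profile n x +
      x ^ 2 * poly (rv (n div 2 - 1) q) (x ^ 2)) has_integral 0) {0..1}"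
proof -
  define m where "m = n div 2"
  have n: "n = 2 * m + e" by (simp add: m_def e_def)
  \<comment> \<open>Here j = m - d, so that 2 d + e = n - 2 j. The tail contributes x^(n-2j)
    x^(-n-2) = x^(-2j-2) on [1, \<infinity>), which becomes x^(2j) on [0, 1]; collected over d this
    is the reversal of \<open>q\<close>.\<close>
  have monomial: "((\<lambda>x. (\<Sum>i\<le>m. (-1) ^ i * thag_coeff n i * x ^ (2 * d + e + (n - 2 * i))) +
      x ^ (2 * (m - d))) has_integral 0) {0..1}" if d: "d < m" for d
  proof -
    have "((\<lambda>x. (\<Sum>i\<le>m. (-1) ^ i * thag_coeff n i * x ^ (2 * d + e + (n - 2 * i))) + x ^ (2 * (m - d)))
      has_integral (\<Sum>i\<le>m. (-1) ^ i * thag_coeff n i * (1 / (real (2 * d + e + (n - 2 * i)) + 1))) +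
        1 / (real (2 * (m - d)) + 1)) {0..1}"
      by (intro has_integral_add has_integral_sum has_integral_mult_right has_integral_power_unit) auto
    moreover have "(\<Sum>i\<le>m. (-1) ^ i * thag_coeff n i * (1 / (real (2 * d + e + (n - 2 * i)) + 1))) =
        (\<Sum>i\<le>n. (-1) ^ i * thag_coeff n i / (2 * real n - 2 * real i - 2 * real (m - d) + 1))"
    proof (intro sum.mono_neutral_cong_left ballI)
      fix i assume "i \<in> {..n} - {..m}"
      then show "(-1) ^ i * thag_coeff n i / (2 * real n - 2 * real i - 2 * real (m - d) + 1) = 0"
        using thag_coeff_eq_0[of n i] by (auto simp: m_def)
    next
      fix i assume "i \<in> {..m}"
      then have "real (2 * d + e + (n - 2 * i)) + 1 = 2 * real n - 2 * real i - 2 * real (m - d) + 1"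
        using d by (simp add: n of_nat_diff)
      then show "(-1) ^ i * thag_coeff n i * (1 / (real (2 * d + e + (n - 2 * i)) + 1)) =
          (-1) ^ i * thag_coeff n i / (2 * real n - 2 * real i - 2 * real (m - d) + 1)"
        by simp
    qed (auto simp: n)
    moreover have "1 \<le> m - d" "2 * (m - d) \<le> n" using d by (auto simp: n)
    ultimately show ?thesis
      using thag_coeff_moment[of "m - d" n] by simp
  qed
  have "((\<lambda>x. \<Sum>d<m. coeff q d * ((\<Sum>i\<le>m. (-1) ^ i * thag_coeff n i * x ^ (2 * d + e + (n - 2 * i))) +
      x ^ (2 * (m - d)))) has_integral (\<Sum>d<m. coeff q d * 0)) {0..1}"
    by (intro has_integral_sum has_integral_mult_right monomial) auto
  moreover have "(\<Sum>d<m. coeff q d * ((\<Sum>i\<le>m. (-1) ^ i * thag_coeff n i * x ^ (2 * d + e + (n - 2 * i))) +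
      x ^ (2 * (m - d)))) = x ^ e * poly q (x ^ 2) * thag_profile n x +
      x ^ 2 * poly (rv (m - 1) q) (x ^ 2)" for x
  proof -
    have q_eq: "poly q y = (\<Sum>d<m. coeff q d * y ^ d)" for y
      unfolding poly_altdef using q by (intro sum.mono_neutral_left) (auto simp: m_def coeff_eq_0)
    have "{..m - 1} = {..<m}" using q by (auto simp: m_def)
    then have "poly (rv (m - 1) q) y = (\<Sum>d<m. coeff q (m - 1 - d) * y ^ d)" for y
      by (simp add: rv_def poly_sum poly_monom)
    also have "\<dots> y = (\<Sum>d<m. coeff q d * y ^ (m - 1 - d))" for y
      by (rule sum.reindex_bij_witness[of _ "\<lambda>d. m - 1 - d" "\<lambda>d. m - 1 - d"]) auto
    finally have "x ^ 2 * poly (rv (m - 1) q) (x ^ 2) = (\<Sum>d<m. coeff q d * (x ^ 2 * (x ^ 2) ^ (m - 1 - d)))"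
      by (simp add: sum_distrib_left mult_ac)
    also have "\<dots> = (\<Sum>d<m. coeff q d * x ^ (2 * (m - d)))"
    proof (intro sum.cong refl)
      fix d assume "d \<in> {..<m}"
      then have "Suc (m - 1 - d) = m - d" by auto
      then have "x ^ 2 * (x ^ 2) ^ (m - 1 - d) = (x ^ 2) ^ (m - d)"
        by (metis power_Suc)
      then show "coeff q d * (x ^ 2 * (x ^ 2) ^ (m - 1 - d)) = coeff q d * x ^ (2 * (m - d))"
        by (simp only: power_mult)
    qed
    finally have rev: "x ^ 2 * poly (rv (m - 1) q) (x ^ 2) = (\<Sum>d<m. coeff q d * x ^ (2 * (m - d)))" .
    have "x ^ e * poly q (x ^ 2) * thag_profile n x =
        (\<Sum>d<m. coeff q d * ((x ^ 2) ^ d * x ^ e * thag_profile n x))"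
      unfolding q_eq by (simp only: sum_distrib_left sum_distrib_right mult_ac)
    also have "\<dots> = (\<Sum>d<m. coeff q d * (\<Sum>i\<le>m. (-1) ^ i * thag_coeff n i * x ^ (2 * d + e + (n - 2 * i))))"
      unfolding thag_profile_def m_def[symmetric] sum_distrib_left
      by (intro sum.cong refl) (simp only: power_add power_mult[symmetric] mult_ac)
    finally have "x ^ e * poly q (x ^ 2) * thag_profile n x =
        (\<Sum>d<m. coeff q d * (\<Sum>i\<le>m. (-1) ^ i * thag_coeff n i * x ^ (2 * d + e + (n - 2 * i))))" .
    then show ?thesis
      unfolding rev by (simp only: distrib_left sum.distrib)
  qed
  ultimately show ?thesis
    unfolding m_def by simp
qed

section \<open>Counting sign changes\<close>

lemma coeff_monic_prod:
  fixes Z :: "real set"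
  assumes "finite Z"
  shows "degree (\<Prod>z\<in>Z. [:-z, 1:]) = card Z" and "lead_coeff (\<Prod>z\<in>Z. [:-z, 1:]) = 1"
  by (simp add: degree_prod_eq_sum_degree) (subst lead_coeff_prod, simp)

text \<open>This compares a factor y - c of the test polynomial with the factor 1 - c y of its
  reversal.\<close>

lemma abs_diff_le_one_minus_mult:
  fixes y c :: real
  assumes "0 \<le> y" "y \<le> 1" "0 \<le> c" "c \<le> 1"
  shows "\<bar>y - c\<bar> \<le> 1 - c * y"
proof -
  have "0 \<le> (1 - y) * (1 + c)" "0 \<le> (1 + y) * (1 - c)"
    using assms by simp_all
  then show ?thesis by (simp add: algebra_simps abs_le_iff)
qed

lemma thag_perturbed_roots:
  fixes n :: nat and l :: real
  assumes n: "2 \<le> n" and l: "0 \<le> l" "l \<le> real n / 2"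
  defines "p \<equiv> thag_poly n + monom l 1"
  shows "\<exists>Z c. finite Z \<and> card Z = n div 2 \<and> Z \<subseteq> {..<0} \<and> c \<noteq> 0 \<and> p = smult c (\<Prod>z\<in>Z. [:-z, 1:])"
proof -
  define m where "m = n div 2"
  define e where "e = n mod 2"
  have nm: "n = 2 * m + e" and m: "1 \<le> m" using n by (auto simp: m_def e_def)
  have deg: "degree p \<le> m"
    unfolding p_def using degree_thag_poly[of n] m degree_monom_le[of l 1]
    by (intro degree_add_le) (auto simp: m_def)
  have lead: "0 < coeff p m"
  proof -
    have "coeff (thag_poly n) m = (\<Sum>i\<le>n. if i = m then thag_coeff n m else 0)"
      unfolding thag_poly_def coeff_sum
    proof (intro sum.cong refl)
      fix i assume i: "i \<in> {..n}"
      consider "i < m" | "i = m" | "i > m" by linarith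
      then show "coeff (smult (thag_coeff n i) ([:-1, 1:] ^ i)) m = (if i = m then thag_coeff n m else 0)"
        using i thag_coeff_eq_0[of n i]
        by cases (auto simp: coeff_eq_0 degree_power_eq coeff_linear_poly_power m_def)
    qed
    also have "\<dots> = thag_coeff n m" using nm by simp
    also have "0 < \<dots>" using nm by (auto simp: thag_coeff_def)
    finally show ?thesis using l by (simp add: p_def)
  qed
  then have deg_eq: "degree p = m"
    using deg le_degree[of p m] by auto
  have p0: "poly p 0 = 1"
  proof -
    have "poly (thag_poly n) 0 = (\<Sum>i\<le>n. (-1) ^ i * thag_coeff n i)"
      by (simp add: poly_thag_poly mult.commute)
    then show ?thesis by (simp add: p_def poly_monom sum_thag_coeff)
  qed
  obtain Z h where Z: "finite Z" "Z \<subseteq> {..<0}" and p_eq: "p = (\<Prod>z\<in>Z. [:-z, 1:]) * h"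
    and sign: "(\<forall>t\<le>0. 0 \<le> poly h t) \<or> (\<forall>t\<le>0. poly h t \<le> 0)"
    using real_poly_sign_decomposition[of p] by blast
  define r where "r = card Z"
  have "h \<noteq> 0" using p0 p_eq by auto
  have prod_neq: "(\<Prod>z\<in>Z. [:-z, 1:]) \<noteq> 0" using Z(1) by (simp add: prod_zero_iff)
  have deg_h: "r + degree h = m"
    using deg_eq coeff_monic_prod(1)[OF Z(1)] \<open>h \<noteq> 0\<close> prod_neq unfolding p_eq r_def
    by (simp add: degree_mult_eq)
  have lead_h: "0 < lead_coeff h"
    using lead coeff_monic_prod(2)[OF Z(1)] unfolding deg_eq[symmetric] p_eq lead_coeff_mult by simp
  have h_nonneg: "0 \<le> poly h t" if "t \<le> 0" for t
  proof -
    have "0 < (\<Prod>z\<in>Z. - z)" using Z(2) by (intro prod_pos) auto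
    moreover have "(\<Prod>z\<in>Z. - z) * poly h 0 = 1"
      using p0 unfolding p_eq by (simp add: poly_prod)
    ultimately have "0 < poly h 0"
      by (metis zero_less_mult_pos zero_less_one)
    then show ?thesis using sign that by (auto simp: not_le[symmetric])
  qed
  \<comment> \<open>A linear \<open>h\<close> with positive leading coefficient would be negative
    far to the left. Thus the shortfall is at least two, which makes k \<ge> 1 below.\<close>
  have "r \<noteq> m - 1"
  proof
    assume "r = m - 1"
    then have d1: "degree h = 1" using deg_h m by linarith
    then have h_eq: "poly h t = coeff h 0 + coeff h 1 * t" for t
      by (simp add: poly_altdef)
    have pos: "0 < coeff h 1" using lead_h d1 by simp
    define t where "t = - (\<bar>coeff h 0\<bar> + 1) / coeff h 1"
    have "poly h t < 0" using pos by (simp add: h_eq t_def)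
    moreover have "t \<le> 0" using pos by (simp add: t_def divide_nonpos_pos)
    ultimately show False using h_nonneg[of t] by simp
  qed
  moreover have "\<not> r + 2 \<le> m"
  proof
    assume r2: "r + 2 \<le> m"
    \<comment> \<open>The factor y^k fills \<open>q\<close> up to degree m - 1. It is positive for y
      > 0, it damps the term with \<lambda>, and it disappears in the reversal at degree m -
      1.\<close>
    define k where "k = m - 1 - r"
    \<comment> \<open>With y = x^2 the substitution is t = 1 - 1 / y; \<open>c z\<close> is the y
      that corresponds to t = z. Hence y - c z and t - z have the same sign.\<close>
    define c where "c z = 1 / (1 - z)" for z :: real
    define R where "R = (\<Prod>z\<in>Z. [:- c z, 1:])"
    define q where "q = monom 1 k * R"
    define rev where "rev y = (\<Prod>z\<in>Z. 1 - c z * y)" for y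
    define E where "E x = x ^ e * poly q (x ^ 2) * thag_profile n x +
      x ^ 2 * poly (rv (m - 1) q) (x ^ 2)" for x
    have k: "1 \<le> k" "k + r = m - 1" using r2 by (auto simp: k_def)
    have c: "0 < c z" "c z < 1" "1 - z \<noteq> 0" if "z \<in> Z" for z
      using Z(2) that by (auto simp: c_def)
    have deg_R: "degree R \<le> r"
      using degree_prod_sum_le[OF Z(1), of "\<lambda>z. [:- c z, 1:]"] by (simp add: R_def r_def o_def)
    have "degree q \<le> k + r"
      unfolding q_def using degree_mult_le[of "monom 1 k" R] degree_monom_le[of "1::real" k] deg_R by linarith
    then have deg_q: "degree q < n div 2"
      using k m by (simp add: m_def)
    have int: "(E has_integral 0) {0..1}"
      unfolding E_def e_def m_def by (rule has_integral_thag_profile[OF deg_q])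
    have poly_R: "poly R y = (\<Prod>z\<in>Z. y - c z)" for y
      by (simp add: R_def poly_prod)
    have poly_q: "poly q y = y ^ k * (\<Prod>z\<in>Z. y - c z)" for y
      by (simp add: q_def poly_monom poly_R)
    have poly_rev: "poly (rv (m - 1) q) y = rev y" if "y \<noteq> 0" for y
    proof -
      have "poly (rv (m - 1) q) y = y ^ r * (\<Prod>z\<in>Z. 1 / y - c z)"
        unfolding k(2)[symmetric] q_def rv_monom_mult using poly_rv[OF deg_R that] by (simp add: poly_R)
      also have "\<dots> = (\<Prod>z\<in>Z. y * (1 / y - c z))"
        by (simp add: prod.distrib r_def)
      also have "\<dots> = rev y"
        unfolding rev_def using that by (intro prod.cong) (auto simp: field_simps)
      finally show ?thesis .
    qed
    have rev_pos: "0 < rev y" if "0 \<le> y" "y \<le> 1" for y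
      unfolding rev_def
    proof (intro prod_pos)
      fix z assume z: "z \<in> Z"
      then have "c z * y \<le> c z * 1" using c that by (intro mult_left_mono) (auto intro: less_imp_le)
      then show "0 < 1 - c z * y" using c(2)[OF z] by simp
    qed
    have nonneg: "0 \<le> E x" if x: "0 < x" "x < 1" for x
    proof -
      define y where "y = x ^ 2"
      define t where "t = 1 - 1 / y"
      have y: "0 < y" "y < 1" using x by (auto simp: y_def power_less_one_iff)
      then have t: "t \<le> 0" by (simp add: t_def)
      have xn: "x ^ e * x ^ n = y ^ (m + e)"
        by (simp add: y_def nm power_add[symmetric] power_mult[symmetric] algebra_simps)
      have prof: "thag_profile n x = x ^ n * (poly p t - l * t)"
        using thag_profile_eq[of x n] x by (simp add: p_def poly_monom t_def y_def)
      have "0 \<le> poly q y * poly p t"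
      proof -
        have "poly q y * poly p t = y ^ k * (\<Prod>z\<in>Z. (y - c z) * (t - z)) * poly h t"
          by (simp add: poly_q p_eq poly_prod prod.distrib)
        moreover have "0 \<le> (y - c z) * (t - z)" if z: "z \<in> Z" for z
        proof -
          have "t - z = (1 - z) * (y - c z) / y"
            using c(3)[OF z] y by (simp add: t_def c_def field_simps)
          then have "(y - c z) * (t - z) = (1 - z) * (y - c z) ^ 2 / y"
            by (simp add: power2_eq_square)
          moreover have "0 < 1 - z" using Z(2) z by auto
          ultimately show ?thesis using y by simp
        qed
        ultimately show ?thesis
          using y h_nonneg[OF t] by (simp add: prod_nonneg)
      qed
      then have "0 \<le> y ^ (m + e) * (poly q y * poly p t)"
        using y by simp
      \<comment> \<open>The profile involves p - \<lambda> t and not \<open>p\<close>; the extra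
        term changes sign with \<open>q\<close> and is outweighed by the tail y * rev y. Factor by
        factor the product in \<open>q\<close> is at most \<open>rev y\<close> in absolute value, so
        its weight only has to be at most y.\<close>
      moreover have "0 \<le> y * rev y + y ^ (m + e) * poly q y * (- l * t)"
      proof -
        \<comment> \<open>Since - t = (1 - y) / y, the weight y^(m+e+k) (- \<lambda> t) is y times
          \<lambda> y^M (1 - y). As k \<ge> 1, M + 1 \<ge> m + e \<ge> n/2 \<ge> \<lambda>.\<close>
        define M where "M = m + e - 2 + k"
        have "\<bar>\<Prod>z\<in>Z. y - c z\<bar> \<le> rev y"
          unfolding rev_def abs_prod using y c
          by (intro prod_mono conjI abs_ge_zero abs_diff_le_one_minus_mult) (auto simp: less_imp_le)
        have "real n / 2 \<le> real (M + 1)"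
          using k(1) r2 by (simp add: M_def nm)
        then have "l * (y ^ M * (1 - y)) \<le> real (M + 1) * (y ^ M * (1 - y))"
          using l y by (intro mult_right_mono) auto
        also have "\<dots> \<le> 1"
          using y by (intro power_mult_one_minus_le) auto
        finally have lM: "l * (y ^ M * (1 - y)) \<le> 1" .
        have "m + e + k = M + 2" using r2 by (simp add: M_def)
        then have "y ^ (M + 2) = y ^ (m + e) * y ^ k"
          by (simp only: power_add[symmetric])
        then have "y ^ (m + e) * poly q y * (- l * t) = y ^ (M + 2) * (- l * t) * (\<Prod>z\<in>Z. y - c z)"
          by (simp only: poly_q mult_ac)
        also have "y ^ (M + 2) * (- l * t) = y * (l * (y ^ M * (1 - y)))"
          using y by (simp add: t_def field_simps power2_eq_square)
        finally have eq: "y ^ (m + e) * poly q y * (- l * t) = y * (l * (y ^ M * (1 - y))) * (\<Prod>z\<in>Z. y - c z)" .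
        have "\<bar>y * (l * (y ^ M * (1 - y))) * (\<Prod>z\<in>Z. y - c z)\<bar> \<le> y * 1 * rev y"
          unfolding abs_mult[of "y * (l * (y ^ M * (1 - y)))"]
        proof (intro mult_mono)
          show "\<bar>y * (l * (y ^ M * (1 - y)))\<bar> \<le> y * 1"
            using lM y l by (simp add: abs_mult)
        qed (use \<open>\<bar>\<Prod>z\<in>Z. y - c z\<bar> \<le> rev y\<close> y in auto)
        then show ?thesis unfolding eq by simp
      qed
      ultimately have "0 \<le> y ^ (m + e) * (poly q y * poly p t) + (y * rev y + y ^ (m + e) * poly q y * (- l * t))"
        by (rule add_nonneg_nonneg)
      also have "\<dots> = E x"
      proof -
        have "x ^ e * poly q y * (x ^ n * (poly p t - l * t)) = y ^ (m + e) * poly q y * (poly p t - l * t)"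
          by (simp add: xn[symmetric] mult_ac)
        then show ?thesis
          unfolding E_def y_def[symmetric] prof using poly_rev[of y] y by (simp add: algebra_simps)
      qed
      finally show ?thesis .
    qed
    have "continuous_on {0..1} E"
      unfolding E_def thag_profile_def by (intro continuous_intros)
    \<comment> \<open>A continuous function that is nonnegative inside the interval and has integral
      0 vanishes at the endpoint too. But at 1 the profile has the value P_n(0) = 1, so
      \<open>E 1\<close> is twice \<open>rev 1\<close>.\<close>
    then have "E 1 = 0"
      using has_integral_0_cbox_imp_0[of 0 1 E 1] nonneg int by (simp add: box_real cbox_interval)
    moreover have "0 < E 1"
    proof -
      have "thag_profile n 1 = 1"
        using thag_profile_eq[of 1 n] p0 by (simp add: p_def poly_monom)
      moreover have "poly q 1 = rev 1" by (simp add: poly_q rev_def)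
      ultimately show ?thesis
        using poly_rev[of 1] rev_pos[of 1] by (simp add: E_def)
    qed
    ultimately show False by simp
  qed
  ultimately have "r = m" using deg_h by linarith
  then have "degree h = 0" using deg_h by simp
  then obtain a where a: "h = [:a:]" by (elim degree_eq_zeroE)
  then have "a \<noteq> 0" "p = smult a (\<Prod>z\<in>Z. [:-z, 1:])"
    using \<open>h \<noteq> 0\<close> by (auto simp: p_eq)
  then show ?thesis
    using Z \<open>r = m\<close> by (intro exI[of _ Z] exI[of _ a]) (simp add: r_def m_def)
qed

section \<open>Transfer to complex zeros\<close>

lemma order_linear_prod:
  fixes z :: "'a::field"
  assumes "finite S" and "z \<in> S" and "a \<noteq> 0"
  shows "order z (smult a (\<Prod>w\<in>S. [:-w, 1:])) = 1"
proof -
  define q where "q = (\<Prod>w\<in>S - {z}. [:-w, 1:])"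
  have split: "(\<Prod>w\<in>S. [:-w, 1:]) = [:-z, 1:] * q"
    unfolding q_def by (rule prod.remove[OF assms(1,2)])
  have "poly q z \<noteq> 0"
    using assms(1) by (auto simp: q_def poly_prod prod_zero_iff)
  then have "order z q = 0"
    by (simp add: order_root)
  moreover have nonzero: "[:-z, 1:] * q \<noteq> 0"
    unfolding mult_eq_0_iff using \<open>poly q z \<noteq> 0\<close> by auto
  moreover have "order z [:-z, 1:] = 1"
    using order_power_n_n[of z 1] by simp
  ultimately show ?thesis
    by (simp only: split order_smult[OF assms(3)] order_mult[OF nonzero] add_0_right)
qed

lemma map_poly_of_real_linear_prod:
  assumes "finite Z"
  shows "map_poly of_real (smult a (\<Prod>z\<in>Z. [:-z, 1:])) =
    smult (of_real a) (\<Prod>w\<in>(of_real ` Z :: complex set). [:-w, 1:])"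
proof -
  have "map_poly of_real (\<Prod>z\<in>Z. [:-z, 1:]) = (\<Prod>z\<in>Z. [:- complex_of_real z, 1:])"
    using assms
  proof (induction Z)
    case (insert z Z)
    have "map_poly of_real ([:-z, 1:] * q) = [:- complex_of_real z, 1:] * map_poly of_real q" for q
      by (rule poly_eqI) (simp add: coeff_map_poly coeff_pCons split: nat.split)
    then show ?case using insert by (simp only: prod.insert[OF insert.hyps])
  qed simp
  also have "\<dots> = (\<Prod>w\<in>of_real ` Z. [:-w, 1:])"
    by (subst prod.reindex) (auto simp: inj_on_def)
  moreover have "map_poly of_real (smult a q) = smult (complex_of_real a) (map_poly of_real q)" for q
    by (rule poly_eqI) (simp add: coeff_map_poly)
  ultimately show ?thesis by simp
qed

theorem theorem1p1:
  fixes n :: nat and l :: real and p :: "complex poly"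
  assumes "n \<ge> 2" and "0 \<le> l" and "l \<le> real n / 2"
  defines "p \<equiv> map_poly of_int (KL_K11 n) + monom (complex_of_real l) 1"
  shows "card {z. poly p z = 0} = n div 2 \<and>
         (\<forall>z. poly p z = 0 \<longrightarrow> z \<in> \<real> \<and> Re z < 0 \<and> order z p = 1)"
proof -
  obtain Z a where Z: "finite Z" "card Z = n div 2" "Z \<subseteq> {..<0}" and a: "a \<noteq> 0"
    and real: "thag_poly n + monom l 1 = smult a (\<Prod>z\<in>Z. [:-z, 1:])"
    using thag_perturbed_roots[OF assms(1-3)] by blast
  define S where "S = (complex_of_real ` Z)"
  have "p = map_poly of_real (map_poly of_int (KL_K11 n) + monom l 1)"
    unfolding p_def by (rule poly_eqI) (simp add: coeff_map_poly)
  then have p: "p = smult (of_real a) (\<Prod>w\<in>S. [:-w, 1:])"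
    unfolding KL_K11_eq_thag_poly real S_def map_poly_of_real_linear_prod[OF Z(1)] .
  have S: "finite S" "card S = n div 2"
    using Z by (auto simp: S_def card_image inj_on_def)
  have roots: "poly p z = 0 \<longleftrightarrow> z \<in> S" for z
    using S(1) a by (auto simp: p poly_prod prod_zero_iff)
  then show ?thesis
    using S Z(3) order_linear_prod[OF S(1), of _ "of_real a"] a by (auto simp: p S_def)
qed

end
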